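(* Let $s$ be an odd positive integer, $k$ a positive integer, $n\ge0$ an integer, and $\mu$ a strict partition of $n$. Then $$T^{(s)}_kQ_\mu.1=\sum_{\lambda}2^{l(\mu)-l(\lambda)}\operatorname{Pf}(\tilde M(\lambda/\mu))\,Q_\lambda.1,$$ where the sum runs over all strict partitions $\lambda$ of $n+sk$ such that $\mu\subset\lambda$.
   Context: A strict partition has distinct positive parts; $l(\cdot)$ is the number of positive parts; $\mu\subset\lambda$ means $\mu_i\le\lambda_i$ for all $i$. Let $\Gamma_{\mathbb Q}=\mathbb Q[p_1,p_3,p_5,\dots]$. Define operators $Q_m$ ($m\in\mathbb Z$) on $\Gamma_{\mathbb Q}$ by $$Q(z)=\exp\Big(\sum_{m\ge1\text{ odd}}\tfrac2m p_mz^m\Big)\exp\Big(-\sum_{m\ge1\text{ odd}}\tfrac{\partial}{\partial p_m}z^{-m}\Big)=\sum_{m\in\mathbb Z}Q_mz^m ,$$ and for $\lambda=(\lambda_1,\dots,\lambda_l)$ put $Q_\lambda.1=Q_{\lambda_1}\cdots Q_{\lambda_l}.1$ (this is the Schur $Q$-function $Q_\lambda$ for $\lambda$ strict). The multiplication operators $T^{(s)}_m$ on $\Gamma_{\mathbb Q}$ are defined by $\exp\big(2\sum_{m\ge1\text{ odd}}\frac{p_{sm}}{m}z^{m}\big)=\sum_{m\ge0}T^{(s)}_mz^{m}$. The numbers $f$: for $j\in\mathbb Z$, $f_j=1$ if $j=0$, $f_j=2$ if $j>0$ and $s\mid j$, and $f_j=0$ otherwise. For $m,n\ge0$, $f_{(m,n)}=f_mf_n+2\sum_{j=1}^n(-1)^jf_{m+j}f_{n-j}$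 if $n\ge1$, and $f_{(m,0)}=f_m$. The matrix: write $\lambda=(\lambda_1,\dots,\lambda_b)$ with $b=l(\lambda)$ and $\mu=(\mu_1,\dots,\mu_a)$ with $a=l(\mu)$ if $l(\lambda)+l(\mu)$ is even, and $a=l(\mu)+1$, $\mu_a=0$ if $l(\lambda)+l(\mu)$ is odd, so that $a+b$ is even. Then $\tilde M(\lambda/\mu)$ is the antisymmetric $(a+b)\times(a+b)$ block matrix $\begin{pmatrix}0&X\\-X^T&Y\end{pmatrix}$ with zero $a\times a$ block, $X_{ij}=f_{\lambda_j-\mu_{a-i+1}}$ ($1\le i\le a$, $1\le j\le b$), and $Y$ the antisymmetric $b\times b$ matrix with $Y_{ij}=f_{(\lambda_i,\lambda_j)}$ for $1\le i<j\le b$. $\operatorname{Pf}$ denotes the Pfaffian (normalized so that $\operatorname{Pf}\begin{pmatrix}0&x\\-x&0\end{pmatrix}=x$; the Pfaffian of the empty matrix is $1$). *)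

theory Defs
  imports
    Complex_Main
    "HOL-Library.Poly_Mapping"
    "HOL-Combinatorics.Permutations"
    "HOL-Computational_Algebra.Formal_Power_Series"
    "Jordan_Normal_Form.Matrix"
begin

section \<open>The ring of rational polynomials in $p_1, p_3, p_5, \ldots$\<close>

text \<open>
  Monomials are finitely supported exponent functions. The variable with index \<open>i\<close>
  stands for $p_{2i+1}$, so that the type consists exactly of the polynomials in
  $p_1, p_3, p_5, \ldots$ over the rationals.
\<close>

type_synonym gamma = "(nat \<Rightarrow>\<^sub>0 nat) \<Rightarrow>\<^sub>0 rat"

definition scalar :: "rat \<Rightarrow> gamma" where
  "scalar c = Poly_Mapping.single 0 c"

text \<open>The variable $p_m$ and the derivation $\partial/\partial p_m$; only odd \<open>m\<close> is meaningful.\<close>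

definition pvar :: "nat \<Rightarrow> gamma" where
  "pvar m = Poly_Mapping.single (Poly_Mapping.single (m div 2) 1) 1"

definition pdiff :: "nat \<Rightarrow> gamma \<Rightarrow> gamma" where
  "pdiff m f =
     (\<Sum>\<alpha>\<in>Poly_Mapping.keys f.
        Poly_Mapping.single (\<alpha> - Poly_Mapping.single (m div 2) 1)
          (of_nat (Poly_Mapping.lookup \<alpha> (m div 2)) * Poly_Mapping.lookup f \<alpha>))"


section \<open>Vertex operators\<close>

text \<open>
  The exponential $\sum_k F^k / k!$ of a power series \<open>F\<close> with vanishing constant term.
  The coefficient of $z^n$ in $F^k$ is zero for $k > n$, so the sum may stop at \<open>n\<close>.
\<close>

definition exp_series :: "gamma fps \<Rightarrow> gamma fps" where
  "exp_series F = Abs_fps (\<lambda>n. \<Sum>k\<le>n. scalar (1 / fact k) * fps_nth (F ^ k) n)"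

definition q_series :: "gamma fps" where
  "q_series = exp_series (Abs_fps (\<lambda>m. if odd m then scalar (2 / of_nat m) * pvar m else 0))"

text \<open>
  With $w = z^{-1}$, this is the operator $-\sum_{m\ \mathrm{odd}} \frac{\partial}{\partial p_m} w^m$
  acting on power series in \<open>w\<close> with polynomial coefficients.
\<close>

definition diff_series_op :: "gamma fps \<Rightarrow> gamma fps" where
  "diff_series_op F =
     Abs_fps (\<lambda>n. - (\<Sum>m | odd m \<and> m \<le> n. pdiff m (fps_nth F (n - m))))"

text \<open>
  The coefficient of $z^{-j}$ in
  $\exp\bigl(-\sum_{m\ \mathrm{odd}} \frac{\partial}{\partial p_m} z^{-m}\bigr) f$;
  again the terms of the exponential series with $k > j$ do not contribute.
\<close>

definition exp_diff_coeff :: "nat \<Rightarrow> gamma \<Rightarrow> gamma" where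
  "exp_diff_coeff j f =
     (\<Sum>k\<le>j. scalar (1 / fact k) * fps_nth ((diff_series_op ^^ k) (fps_const f)) j)"

text \<open>
  The operator $Q_m$. The sum is finite by \<open>finite_exp_diff_coeff_support\<close> below.
\<close>

definition Q_op :: "int \<Rightarrow> gamma \<Rightarrow> gamma" where
  "Q_op m f =
     (\<Sum>j | m + int j \<ge> 0 \<and> exp_diff_coeff j f \<noteq> 0.
        fps_nth q_series (nat (m + int j)) * exp_diff_coeff j f)"

definition Q_fun :: "nat list \<Rightarrow> gamma" where
  "Q_fun lam = foldr (\<lambda>m. Q_op (int m)) lam 1"

definition T_mult :: "nat \<Rightarrow> nat \<Rightarrow> gamma" where
  "T_mult s m =
     fps_nth (exp_series
       (Abs_fps (\<lambda>m. if odd m then scalar 2 * (scalar (1 / of_nat m) * pvar (s * m)) else 0))) m"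

definition T_op :: "nat \<Rightarrow> nat \<Rightarrow> gamma \<Rightarrow> gamma" where
  "T_op s m f = T_mult s m * f"


section \<open>Strict partitions\<close>

text \<open>
  A strict partition is the list of its positive parts, so $l(\lambda)$ is the length
  of the list.
\<close>

definition strict_partition :: "nat list \<Rightarrow> bool" where
  "strict_partition lam \<longleftrightarrow> sorted_wrt (>) lam \<and> (\<forall>x\<in>set lam. x > 0)"

definition strict_partition_of :: "nat \<Rightarrow> nat list \<Rightarrow> bool" where
  "strict_partition_of n lam \<longleftrightarrow> strict_partition lam \<and> sum_list lam = n"

definition part :: "nat list \<Rightarrow> nat \<Rightarrow> nat" where
  "part lam i = (if i < length lam then lam ! i else 0)"

definition part_subset :: "nat list \<Rightarrow> nat list \<Rightarrow> bool" where
  "part_subset mu lam \<longleftrightarrow> (\<forall>i. part mu i \<le> part lam i)"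


section \<open>Pfaffians and the matrix of a skew shape\<close>

text \<open>
  For an antisymmetric matrix of size $2n$,
  $\mathrm{Pf}(A) = \frac{1}{2^n n!} \sum_{\sigma} \mathrm{sgn}(\sigma)
     \prod_{i=1}^{n} A_{\sigma(2i-1),\sigma(2i)}$ (indices shifted to start at 0);
  matrices of odd size get the value 0.
\<close>

definition Pfaffian :: "rat mat \<Rightarrow> rat" where
  "Pfaffian A =
     (if even (dim_row A) then
        let n = dim_row A div 2 in
          (\<Sum>\<sigma> | \<sigma> permutes {..<2 * n}.
             of_int (sign \<sigma>) * (\<Prod>i<n. A $$ (\<sigma> (2 * i), \<sigma> (2 * i + 1))))
          / (2 ^ n * fact n)
      else 0)"

definition f_one :: "nat \<Rightarrow> int \<Rightarrow> rat" where
  "f_one s j = (if j = 0 then 1 else if j > 0 \<and> int s dvd j then 2 else 0)"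

definition f_two :: "nat \<Rightarrow> nat \<Rightarrow> nat \<Rightarrow> rat" where
  "f_two s m n =
     (if n = 0 then f_one s (int m)
      else f_one s (int m) * f_one s (int n)
         + 2 * (\<Sum>j=1..n. (-1) ^ j * f_one s (int m + int j) * f_one s (int n - int j)))"

definition pad :: "nat list \<Rightarrow> nat list \<Rightarrow> nat list" where
  "pad lam mu = (if even (length lam + length mu) then mu else mu @ [0])"

definition X_mat :: "nat \<Rightarrow> nat list \<Rightarrow> nat list \<Rightarrow> rat mat" where
  "X_mat s lam mu =
     mat (length mu) (length lam)
       (\<lambda>(i, j). f_one s (int (lam ! j) - int (mu ! (length mu - 1 - i))))"

definition Y_mat :: "nat \<Rightarrow> nat list \<Rightarrow> rat mat" where
  "Y_mat s lam =
     mat (length lam) (length lam)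
       (\<lambda>(i, j). if i < j then f_two s (lam ! i) (lam ! j)
                 else if j < i then - f_two s (lam ! j) (lam ! i)
                 else 0)"

definition M_tilde :: "nat \<Rightarrow> nat list \<Rightarrow> nat list \<Rightarrow> rat mat" where
  "M_tilde s lam mu =
     (let mu' = pad lam mu; X = X_mat s lam mu'
      in four_block_mat (0\<^sub>m (length mu') (length mu')) X (- X\<^sup>T) (Y_mat s lam))"


section \<open>Finiteness of the sums\<close>

definition weight :: "(nat \<Rightarrow>\<^sub>0 nat) \<Rightarrow> nat" where
  "weight \<alpha> = (\<Sum>i\<in>Poly_Mapping.keys \<alpha>. Poly_Mapping.lookup \<alpha> i * (2 * i + 1))"

lemma weight_superset:
  assumes "finite S" "Poly_Mapping.keys \<alpha> \<subseteq> S"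
  shows "weight \<alpha> = (\<Sum>i\<in>S. Poly_Mapping.lookup \<alpha> i * (2 * i + 1))"
  unfolding weight_def using assms
  by (intro sum.mono_neutral_left) (auto simp: in_keys_iff)

lemma weight_add: "weight (\<alpha> + \<beta>) = weight \<alpha> + weight \<beta>"
proof -
  let ?S = "Poly_Mapping.keys \<alpha> \<union> Poly_Mapping.keys \<beta>"
  have S: "finite ?S" "Poly_Mapping.keys (\<alpha> + \<beta>) \<subseteq> ?S"
    using Poly_Mapping.keys_add[of \<alpha> \<beta>] by auto
  show ?thesis
    using weight_superset[OF S] weight_superset[of ?S \<alpha>] weight_superset[of ?S \<beta>] S
    by (simp add: lookup_add algebra_simps sum.distrib)
qed

lemma weight_single: "weight (Poly_Mapping.single i 1) = 2 * i + 1"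
  by (simp add: weight_def)

lemma keys_pdiff:
  assumes "odd m" "\<alpha> \<in> Poly_Mapping.keys (pdiff m f)"
  shows "\<exists>\<beta>\<in>Poly_Mapping.keys f. weight \<beta> = weight \<alpha> + m"
proof -
  let ?e = "Poly_Mapping.single (m div 2) (1 :: nat)"
  from subsetD[OF Poly_Mapping.keys_sum assms(2)[unfolded pdiff_def]]
  obtain \<beta> where \<beta>: "\<beta> \<in> Poly_Mapping.keys f"
    "\<alpha> \<in> Poly_Mapping.keys (Poly_Mapping.single (\<beta> - ?e)
          (of_nat (Poly_Mapping.lookup \<beta> (m div 2)) * Poly_Mapping.lookup f \<beta>))"
    by (rule UN_E)
  then have \<alpha>: "\<alpha> = \<beta> - ?e" and nz: "Poly_Mapping.lookup \<beta> (m div 2) \<noteq> 0"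
    by (auto split: if_splits)
  have "\<beta> = \<alpha> + ?e"
    unfolding \<alpha> using nz
    by (intro poly_mapping_eqI) (auto simp: lookup_add lookup_minus lookup_single when_def)
  then have "weight \<beta> = weight \<alpha> + m"
    using \<open>odd m\<close> weight_add[of \<alpha> ?e] weight_single[of "m div 2"] by simp
  with \<beta>(1) show ?thesis by blast
qed

lemma keys_diff_series_op_power:
  assumes "\<alpha> \<in> Poly_Mapping.keys (fps_nth ((diff_series_op ^^ k) (fps_const f)) j)"
  shows "\<exists>\<beta>\<in>Poly_Mapping.keys f. weight \<beta> = weight \<alpha> + j"
  using assms
proof (induction k arbitrary: \<alpha> j)
  case 0
  then show ?case by (auto split: if_splits)
next
  case (Suc k)
  let ?F = "(diff_series_op ^^ k) (fps_const f)"
  from Suc.prems have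
    "\<alpha> \<in> Poly_Mapping.keys (\<Sum>m | odd m \<and> m \<le> j. pdiff m (fps_nth ?F (j - m)))"
    by (simp add: diff_series_op_def[of ?F])
  then have "\<alpha> \<in> (\<Union>m\<in>{m. odd m \<and> m \<le> j}.
      Poly_Mapping.keys (pdiff m (fps_nth ?F (j - m))))"
    by (rule subsetD[OF Poly_Mapping.keys_sum])
  then obtain m where m: "odd m" "m \<le> j"
    "\<alpha> \<in> Poly_Mapping.keys (pdiff m (fps_nth ?F (j - m)))"
    by blast
  from keys_pdiff[OF m(1,3)] obtain \<beta> where
    \<beta>: "\<beta> \<in> Poly_Mapping.keys (fps_nth ?F (j - m))" "weight \<beta> = weight \<alpha> + m"
    by blast
  from Suc.IH[OF \<beta>(1)] \<beta>(2) m(2) show ?case by auto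
qed

lemma finite_exp_diff_coeff_support: "finite {j. exp_diff_coeff j f \<noteq> 0}"
proof (rule finite_subset)
  show "{j. exp_diff_coeff j f \<noteq> 0} \<subseteq> (\<Union>\<beta>\<in>Poly_Mapping.keys f. {..weight \<beta>})"
  proof
    fix j
    assume "j \<in> {j. exp_diff_coeff j f \<noteq> 0}"
    then obtain k where "scalar (1 / fact k) * fps_nth ((diff_series_op ^^ k) (fps_const f)) j \<noteq> 0"
      unfolding exp_diff_coeff_def using sum.not_neutral_contains_not_neutral by blast
    then have "fps_nth ((diff_series_op ^^ k) (fps_const f)) j \<noteq> 0" by auto
    then obtain \<alpha> where
      "\<alpha> \<in> Poly_Mapping.keys (fps_nth ((diff_series_op ^^ k) (fps_const f)) j)"
      by (metis all_not_in_conv keys_eq_empty)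
    from keys_diff_series_op_power[OF this] obtain \<beta> where
      \<beta>: "\<beta> \<in> Poly_Mapping.keys f" "weight \<beta> = weight \<alpha> + j"
      by blast
    from \<beta>(2) have "j \<in> {..weight \<beta>}" by simp
    with \<beta>(1) show "j \<in> (\<Union>\<beta>\<in>Poly_Mapping.keys f. {..weight \<beta>})" by blast
  qed
qed auto

lemma finite_strict_partition_of: "finite {lam. strict_partition_of n lam}"
proof (rule finite_subset)
  show "{lam. strict_partition_of n lam} \<subseteq> {lam. set lam \<subseteq> {..n} \<and> length lam \<le> n}"
  proof
    fix lam
    assume "lam \<in> {lam. strict_partition_of n lam}"
    then have lam: "\<forall>x\<in>set lam. x > 0" "sum_list lam = n"
      by (auto simp: strict_partition_of_def strict_partition_def)
    have "length lam \<le> sum_list lam"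
      using lam(1) by (induction lam) auto
    then show "lam \<in> {lam. set lam \<subseteq> {..n} \<and> length lam \<le> n}"
      using lam(2) member_le_sum_list by auto
  qed
  show "finite {lam. set lam \<subseteq> {..n} \<and> length lam \<le> n}"
    by (rule finite_lists_length_le) simp
qed

end

theory Submission
  imports Defs "Jordan_Normal_Form.Determinant"
begin

text \<open>
  The operators $Q_m$ are free fermions, multiplication by $T^{(s)} = \sum_k T^{(s)}_k$ acts on
  them linearly by conjugation, and so every coefficient of the expansion is a vacuum expectation
  of a product of fermions, which Wick's theorem evaluates as a Pfaffian.

  Write $D_j$ for \<open>exp_diff_coeff j\<close> and $q_n$ for the coefficients of \<open>q_series\<close>. The series
  $\sum_j D_j w^j$ is the translation $p_m \mapsto p_m - w^m$. It multiplies the exponential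
  $T^{(s)}(u) = \sum_k T^{(s)}_k u^k$ by $(1 - u w^s)/(1 + u w^s)$ (\<open>Dz_T_mult\<close>), and since
  $Q_m = \sum_j q_{m+j} D_j$, this gives
  $Q(z) T^{(s)}(u) = \frac{1 - u z^{-s}}{1 + u z^{-s}} T^{(s)}(u) Q(z)$ (\<open>Q_op_T_mult\<close>). The case
  $s = 1$, where $T^{(1)}_n = q_n$, together with $q(z) q(-z) = 1$ yields the anticommutation
  relations $Q_m Q_n + Q_n Q_m = 2 (-1)^m \delta_{m+n,0}$ (\<open>Q_op_anticommute\<close>).

  The anticommutation relations straighten every word $Q_{m_1} \cdots Q_{m_r}.1$ to a combination of
  $Q_\lambda$ with $\lambda$ strict, and the span of these words is closed under multiplication by
  all $q_n$, hence by all $p_m$, so it is everything (\<open>in_Q_span\<close>). With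
  $Q^*_m = (-1)^m Q_{-m}$ and \<open>eps\<close> the constant term, the coefficient of $Q_\lambda$ in \<open>f\<close> is
  $2^{-l(\lambda)}$ times the constant term of $Q^*_{\lambda_b} \cdots Q^*_{\lambda_1} f$
  (\<open>Q_fun_expansion\<close>).

  For $f = T^{(s)}_k Q_\mu.1$, moving $T^{(s)}_k$ to the left replaces every $Q^*_l$ by
  $\sum_i f_{si} Q^*_{l - si}$, after which \<open>eps\<close> absorbs it (\<open>eps_fold_Q_adj_T_mult\<close>). What is
  left is the vacuum expectation of a product of linear combinations of the $Q_m$, padded by
  $Q_0$, which fixes the vacuum, to even length. By Wick's theorem (\<open>wick\<close>, \<open>vac_eq_pf_list\<close>) it is
  the Pfaffian of the matrix of two-point functions. These are 0 between two factors of $Q_\mu$,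
  $2 f_{\lambda_j - \mu_i}$ (for $\mu_i > 0$) between a factor of $Q_\mu$ and one of $Q_\lambda$, and
  $f_{(\lambda_i, \lambda_j)}$ between two factors of $Q_\lambda$; halving the factors of $Q_\mu$
  gives exactly $\tilde M(\lambda/\mu)$ and the factor $2^{l(\mu)}$. The coefficients of the
  $Q_\lambda$ of wrong degree vanish because \<open>eps\<close> kills nonzero degrees, and those with $\mu \not\subset \lambda$ because some rows of the matrix then have
  their nonzero entries in too few columns (\<open>Pfaffian_M_tilde_eq_0\<close>).
\<close>

section \<open>Polynomials in the odd power sums\<close>

lemma scalar_0 [simp]: "scalar 0 = 0"
  and scalar_1 [simp]: "scalar 1 = 1"
  by (simp_all add: scalar_def)

lemma scalar_add: "scalar (a + b) = scalar a + scalar b"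
  and scalar_diff: "scalar (a - b) = scalar a - scalar b"
  and scalar_uminus: "scalar (- a) = - scalar a"
  and scalar_mult: "scalar (a * b) = scalar a * scalar b"
  by (simp_all add: scalar_def single_add single_diff single_uminus mult_single)

lemma scalar_numeral [simp]: "scalar (numeral n) = numeral n"
  by (simp add: scalar_def)

lemma scalar_of_nat [simp]: "scalar (of_nat n) = of_nat n"
  by (simp add: scalar_def)

lemma scalar_sum: "scalar (sum f A) = (\<Sum>x\<in>A. scalar (f x))"
  by (induction A rule: infinite_finite_induct) (auto simp: scalar_add)

lemma scalar_inverse_cancel:
  assumes "c \<noteq> 0"
  shows "scalar (1 / c) * (scalar c * f) = f" "scalar c * (scalar (1 / c) * f) = f"
  using assms by (simp_all add: mult.assoc[symmetric] scalar_mult[symmetric])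

lemma scalar_cancel:
  assumes "c \<noteq> 0" "scalar c * f = scalar c * g"
  shows "f = g"
  using assms scalar_inverse_cancel(1) by metis

lemma of_nat_cancel:
  fixes f g :: gamma
  assumes "n > 0" "of_nat n * f = of_nat n * g"
  shows "f = g"
  using scalar_cancel[of "of_nat n" f g] assms by simp

lemma monomial_pvar:
  "Poly_Mapping.single (Poly_Mapping.single i 1 + \<beta>) c = pvar (2 * i + 1) * Poly_Mapping.single \<beta> c"
  by (simp add: pvar_def mult_single)

lemma poly_mapping_single_induct [case_names zero add_single]:
  assumes zero: "P 0"
    and add: "\<And>f a b. P f \<Longrightarrow> P (f + Poly_Mapping.single a b)"
  shows "P f"
proof (induction f rule: update_induct)
  case const
  show ?case by (rule zero)
next
  case (update f a b)
  have "Poly_Mapping.update a b f = f + Poly_Mapping.single a b"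
    using update(1)
    by (intro poly_mapping_eqI) (auto simp: lookup_update lookup_add lookup_single when_def in_keys_iff)
  with add[OF update(3)] show ?case by simp
qed

lemma gamma_induct [case_names one scale add pvar]:
  assumes one: "P 1"
    and scale: "\<And>c f. P f \<Longrightarrow> P (scalar c * f)"
    and add: "\<And>f g. P f \<Longrightarrow> P g \<Longrightarrow> P (f + g)"
    and pvar: "\<And>m f. odd m \<Longrightarrow> P f \<Longrightarrow> P (pvar m * f)"
  shows "P f"
proof -
  have zero: "P 0"
    using scale[OF one, of 0] by simp
  have mono: "P (Poly_Mapping.single \<alpha> 1)" for \<alpha>
  proof (induction "\<Sum>i\<in>Poly_Mapping.keys \<alpha>. Poly_Mapping.lookup \<alpha> i" arbitrary: \<alpha> rule: less_induct)
    case less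
    show ?case
    proof (cases "\<alpha> = 0")
      case True
      with one show ?thesis by simp
    next
      case False
      then obtain i where i: "i \<in> Poly_Mapping.keys \<alpha>"
        using keys_eq_empty by blast
      define \<beta> where "\<beta> = \<alpha> - Poly_Mapping.single i 1"
      have \<alpha>: "\<alpha> = Poly_Mapping.single i 1 + \<beta>"
        using i unfolding \<beta>_def
        by (intro poly_mapping_eqI) (auto simp: lookup_add lookup_minus lookup_single when_def in_keys_iff)
      have le: "Poly_Mapping.lookup \<beta> j \<le> Poly_Mapping.lookup \<alpha> j" for j
        by (simp add: \<beta>_def lookup_minus)
      have sub: "Poly_Mapping.keys \<beta> \<subseteq> Poly_Mapping.keys \<alpha>"
        using le by (auto simp: in_keys_iff) (metis le_zero_eq not_gr_zero)
      have "(\<Sum>j\<in>Poly_Mapping.keys \<beta>. Poly_Mapping.lookup \<beta> j)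
          = (\<Sum>j\<in>Poly_Mapping.keys \<alpha>. Poly_Mapping.lookup \<beta> j)"
        using sub by (intro sum.mono_neutral_left) (auto simp: in_keys_iff)
      also have "\<dots> < (\<Sum>j\<in>Poly_Mapping.keys \<alpha>. Poly_Mapping.lookup \<alpha> j)"
        using le i by (intro sum_strict_mono_ex1) (auto simp: \<beta>_def lookup_minus in_keys_iff intro!: bexI[of _ i])
      finally have "P (Poly_Mapping.single \<beta> 1)"
        by (rule less)
      then have "P (pvar (2 * i + 1) * Poly_Mapping.single \<beta> 1)"
        by (intro pvar) auto
      then show ?thesis
        by (simp only: \<alpha> monomial_pvar)
    qed
  qed
  have single: "P (Poly_Mapping.single \<alpha> c)" for \<alpha> c
    using scale[OF mono, of c \<alpha>] by (simp add: scalar_def mult_single)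
  show ?thesis
    by (induction f rule: poly_mapping_single_induct) (auto intro: zero add single)
qed


section \<open>The translation operators $D_j$\<close>

lemma pdiff_superset:
  assumes "finite S" "Poly_Mapping.keys f \<subseteq> S"
  shows "pdiff m f = (\<Sum>\<alpha>\<in>S. Poly_Mapping.single (\<alpha> - Poly_Mapping.single (m div 2) 1)
          (of_nat (Poly_Mapping.lookup \<alpha> (m div 2)) * Poly_Mapping.lookup f \<alpha>))"
  unfolding pdiff_def using assms
  by (intro sum.mono_neutral_left) (auto simp: in_keys_iff)

lemma pdiff_add: "pdiff m (f + g) = pdiff m f + pdiff m g"
proof -
  let ?S = "Poly_Mapping.keys f \<union> Poly_Mapping.keys g"
  have "Poly_Mapping.keys (f + g) \<subseteq> ?S" by (rule Poly_Mapping.keys_add)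
  then show ?thesis
    by (simp add: pdiff_superset[of ?S] lookup_add algebra_simps single_add sum.distrib)
qed

lemma pdiff_single:
  "pdiff m (Poly_Mapping.single \<alpha> c) = Poly_Mapping.single (\<alpha> - Poly_Mapping.single (m div 2) 1)
     (of_nat (Poly_Mapping.lookup \<alpha> (m div 2)) * c)"
  by (subst pdiff_superset[of "{\<alpha>}"]) auto

lemma pdiff_0 [simp]: "pdiff m 0 = 0"
  by (simp add: pdiff_def)

lemma pdiff_1 [simp]: "pdiff m 1 = 0"
  by (metis lookup_zero mult_zero_left of_nat_0 pdiff_single single_one single_zero)

lemma pdiff_scalar: "pdiff m (scalar c * f) = scalar c * pdiff m f"
proof (induction f rule: poly_mapping_single_induct)
  case (add_single f a b)
  then show ?case
    by (simp add: pdiff_add distrib_left scalar_def mult_single pdiff_single algebra_simps)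
qed simp

lemma pdiff_pvar:
  assumes "odd m" "odd m'"
  shows "pdiff m (pvar m' * f) = pvar m' * pdiff m f + (if m = m' then f else 0)"
proof (induction f rule: poly_mapping_single_induct)
  case zero
  show ?case by simp
next
  case (add_single f \<alpha> c)
  define i where "i = m div 2"
  define i' where "i' = m' div 2"
  have eq: "m = m' \<longleftrightarrow> i = i'"
    using assms by (auto simp: i_def i'_def elim!: oddE)
  have "pdiff m (pvar m' * Poly_Mapping.single \<alpha> c)
      = pvar m' * pdiff m (Poly_Mapping.single \<alpha> c) + (if m = m' then Poly_Mapping.single \<alpha> c else 0)"
  proof (cases "Poly_Mapping.lookup \<alpha> i = 0")
    case True
    have "Poly_Mapping.single i 1 + \<alpha> - Poly_Mapping.single i 1 = \<alpha>"
      by (intro poly_mapping_eqI) (auto simp: lookup_add lookup_minus)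
    with True show ?thesis
      by (simp add: pvar_def mult_single pdiff_single eq lookup_add lookup_single when_def
          flip: i_def i'_def)
  next
    case False
    have "Poly_Mapping.single i' 1 + \<alpha> - Poly_Mapping.single i 1
        = Poly_Mapping.single i' 1 + (\<alpha> - Poly_Mapping.single i 1)"
      using False
      by (intro poly_mapping_eqI) (auto simp: lookup_add lookup_minus lookup_single when_def)
    moreover have "Poly_Mapping.single i 1 + (\<alpha> - Poly_Mapping.single i 1) = \<alpha>"
      using False
      by (intro poly_mapping_eqI) (auto simp: lookup_add lookup_minus lookup_single when_def)
    ultimately show ?thesis
      by (auto simp add: pvar_def mult_single pdiff_single eq lookup_add lookup_single when_def
          single_add algebra_simps simp flip: i_def i'_def)
  qed
  with add_single show ?case
    by (simp add: pdiff_add distrib_left algebra_simps)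
qed

lemma diff_series_op_nth:
  "fps_nth (diff_series_op F) n = - (\<Sum>m | odd m \<and> m \<le> n. pdiff m (fps_nth F (n - m)))"
  by (simp add: diff_series_op_def)

lemma diff_series_op_add: "diff_series_op (F + G) = diff_series_op F + diff_series_op G"
  by (rule fps_ext) (simp add: diff_series_op_nth pdiff_add sum.distrib)

lemma diff_series_op_scalar:
  "diff_series_op (fps_const (scalar c) * F) = fps_const (scalar c) * diff_series_op F"
  by (rule fps_ext) (simp add: diff_series_op_nth pdiff_scalar sum_distrib_left)

lemma diff_series_op_X_power:
  "diff_series_op (fps_X ^ a * F) = fps_X ^ a * diff_series_op F"
proof (rule fps_ext)
  fix n
  have "(\<Sum>m | odd m \<and> m \<le> n. pdiff m (fps_nth (fps_X ^ a * F) (n - m)))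
      = (\<Sum>m | odd m \<and> m \<le> n \<and> a \<le> n - m. pdiff m (fps_nth F (n - m - a)))"
    by (rule sum.mono_neutral_cong_right) (auto simp: fps_X_power_mult_nth)
  also have "\<dots> = (if n < a then 0 else
      \<Sum>m | odd m \<and> m \<le> n - a. pdiff m (fps_nth F (n - a - m)))"
    by (auto intro!: sum.cong sum.neutral simp: diff_commute add.commute elim: oddE)
  finally show "fps_nth (diff_series_op (fps_X ^ a * F)) n = fps_nth (fps_X ^ a * diff_series_op F) n"
    by (simp add: diff_series_op_nth fps_X_power_mult_nth)
qed

lemma diff_series_op_pvar:
  assumes "odd a"
  shows "diff_series_op (fps_const (pvar a) * F) = fps_const (pvar a) * diff_series_op F - fps_X ^ a * F"
proof (rule fps_ext)
  fix n
  have "(\<Sum>m | odd m \<and> m \<le> n. pdiff m (pvar a * fps_nth F (n - m)))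
      = (\<Sum>m | odd m \<and> m \<le> n. pvar a * pdiff m (fps_nth F (n - m)))
        + (\<Sum>m | odd m \<and> m \<le> n. if m = a then fps_nth F (n - m) else 0)"
    using assms by (simp add: pdiff_pvar sum.distrib)
  also have "(\<Sum>m | odd m \<and> m \<le> n. if m = a then fps_nth F (n - m) else 0)
      = (if n < a then 0 else fps_nth F (n - a))"
    using assms by (subst sum.delta) auto
  finally show "fps_nth (diff_series_op (fps_const (pvar a) * F)) n
      = fps_nth (fps_const (pvar a) * diff_series_op F - fps_X ^ a * F) n"
    by (simp add: diff_series_op_nth fps_X_power_mult_nth sum_distrib_left)
qed

lemma diff_series_op_power_add:
  "(diff_series_op ^^ k) (F + G) = (diff_series_op ^^ k) F + (diff_series_op ^^ k) G"
  by (induction k) (auto simp: diff_series_op_add)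

lemma diff_series_op_power_scalar:
  "(diff_series_op ^^ k) (fps_const (scalar c) * F) = fps_const (scalar c) * (diff_series_op ^^ k) F"
  by (induction k) (auto simp: diff_series_op_scalar)

text \<open>
  The commutator of $-\sum_m w^m \partial/\partial p_m$ with multiplication by $p_a$ is $-w^a$,
  which commutes with everything, so the \<open>k\<close>-th power obeys the usual power rule.
\<close>

lemma diff_series_op_power_pvar:
  assumes "odd a"
  shows "(diff_series_op ^^ Suc k) (fps_const (pvar a) * F)
    = fps_const (pvar a) * (diff_series_op ^^ Suc k) F
      - fps_const (scalar (of_nat (Suc k))) * (fps_X ^ a * (diff_series_op ^^ k) F)"
proof (induction k)
  case 0
  show ?case using assms by (simp add: diff_series_op_pvar)
next
  case (Suc k)
  have neg: "diff_series_op (G - H) = diff_series_op G - diff_series_op H" for G H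
    using diff_series_op_add[of "G - H" H] by (simp add: algebra_simps)
  have "(diff_series_op ^^ Suc (Suc k)) (fps_const (pvar a) * F)
      = diff_series_op (fps_const (pvar a) * (diff_series_op ^^ Suc k) F
        - fps_const (scalar (of_nat (Suc k))) * (fps_X ^ a * (diff_series_op ^^ k) F))"
    using Suc by simp
  also have "\<dots> = fps_const (pvar a) * (diff_series_op ^^ Suc (Suc k)) F
      - fps_X ^ a * (diff_series_op ^^ Suc k) F
      - fps_const (scalar (of_nat (Suc k))) * (fps_X ^ a * (diff_series_op ^^ Suc k) F)"
    by (simp only: neg diff_series_op_scalar diff_series_op_X_power diff_series_op_pvar[OF assms]
        funpow.simps o_apply)
  also have "\<dots> = fps_const (pvar a) * (diff_series_op ^^ Suc (Suc k)) F
      - fps_const (scalar (of_nat (Suc (Suc k)))) * (fps_X ^ a * (diff_series_op ^^ Suc k) F)"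
  proof -
    have *: "fps_const (scalar (of_nat (Suc (Suc k)))) = 1 + fps_const (scalar (of_nat (Suc k)))"
      by (rule fps_ext) (simp add: scalar_add)
    show ?thesis
      by (simp only: * mult_1 algebra_simps)
  qed
  finally show ?case .
qed

lemma diff_series_op_power_low:
  assumes "j < k"
  shows "fps_nth ((diff_series_op ^^ k) F) j = 0"
  using assms
proof (induction k arbitrary: j)
  case (Suc k)
  have "fps_nth ((diff_series_op ^^ k) F) (j - m) = 0" if "odd m" "m \<le> j" for m
    using that Suc.prems by (intro Suc.IH) (auto elim: oddE)
  then show ?case
    by (auto simp: diff_series_op_nth intro!: sum.neutral)
qed simp

lemma exp_diff_coeff_upto:
  assumes "j \<le> K"
  shows "exp_diff_coeff j f
    = (\<Sum>k\<le>K. scalar (1 / fact k) * fps_nth ((diff_series_op ^^ k) (fps_const f)) j)"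
  unfolding exp_diff_coeff_def using assms
  by (intro sum.mono_neutral_left) (auto simp: diff_series_op_power_low)

lemma exp_diff_coeff_add: "exp_diff_coeff j (f + g) = exp_diff_coeff j f + exp_diff_coeff j g"
  by (simp add: exp_diff_coeff_def diff_series_op_power_add distrib_left sum.distrib
      flip: fps_const_add)

lemma exp_diff_coeff_scalar: "exp_diff_coeff j (scalar c * f) = scalar c * exp_diff_coeff j f"
  by (simp add: exp_diff_coeff_def diff_series_op_power_scalar sum_distrib_left mult.left_commute
      flip: fps_const_mult)

lemma exp_diff_coeff_0 [simp]: "exp_diff_coeff j 0 = 0"
  using exp_diff_coeff_scalar[of j 0 0] by simp

lemma exp_diff_coeff_minus: "exp_diff_coeff j (- f) = - exp_diff_coeff j f"
  using exp_diff_coeff_add[of j "- f" f] by (simp add: eq_neg_iff_add_eq_0)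

lemma exp_diff_coeff_diff: "exp_diff_coeff j (f - g) = exp_diff_coeff j f - exp_diff_coeff j g"
  using exp_diff_coeff_add[of j f "- g"] by (simp add: exp_diff_coeff_minus)

lemma exp_diff_coeff_sum: "exp_diff_coeff j (sum f A) = (\<Sum>x\<in>A. exp_diff_coeff j (f x))"
  by (induction A rule: infinite_finite_induct) (auto simp: exp_diff_coeff_add)

lemma exp_diff_coeff_0_left [simp]: "exp_diff_coeff 0 f = f"
  by (simp add: exp_diff_coeff_def)

lemma exp_diff_coeff_1: "exp_diff_coeff j 1 = (if j = 0 then 1 else 0)"
proof -
  have "(diff_series_op ^^ Suc k) 1 = 0" for k
  proof (induction k)
    case 0
    have "pdiff m (if b then 1 else 0) = 0" for m b
      by simp
    then show ?case
      by (auto intro!: fps_ext sum.neutral simp: diff_series_op_nth)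
  next
    case (Suc k)
    then have "(diff_series_op ^^ Suc (Suc k)) 1 = diff_series_op 0" by simp
    also have "diff_series_op 0 = 0"
      using diff_series_op_scalar[of 0 0] by simp
    finally show ?case .
  qed
  then have *: "(diff_series_op ^^ k) 1 = (if k = 0 then 1 else 0)" for k
    by (cases k) simp_all
  show ?thesis
    by (auto simp: exp_diff_coeff_def * if_distrib if_distribR intro!: sum.neutral)
qed

text \<open>
  The operator $\sum_j D_j w^j$ is the algebra homomorphism $p_a \mapsto p_a - w^a$. The following
  rule, together with linearity and the value at 1, determines it, and every identity between
  compositions of the $D_j$ is proved from it by induction over polynomials.
\<close>

lemma exp_diff_coeff_pvar:
  assumes "odd a"
  shows "exp_diff_coeff j (pvar a * f)
    = pvar a * exp_diff_coeff j f - (if a \<le> j then exp_diff_coeff (j - a) f else 0)"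
proof -
  let ?d = "\<lambda>k f. (diff_series_op ^^ k) (fps_const f)"
  have "exp_diff_coeff j (pvar a * f) = (\<Sum>k\<le>Suc j. scalar (1 / fact k) * fps_nth (?d k (pvar a * f)) j)"
    by (rule exp_diff_coeff_upto) simp
  also have "\<dots> = fps_nth (?d 0 (pvar a * f)) j
      + (\<Sum>k\<le>j. scalar (1 / fact (Suc k)) * fps_nth (?d (Suc k) (pvar a * f)) j)"
    by (subst sum.atMost_Suc_shift) simp
  also have "(\<Sum>k\<le>j. scalar (1 / fact (Suc k)) * fps_nth (?d (Suc k) (pvar a * f)) j)
      = (\<Sum>k\<le>j. scalar (1 / fact (Suc k)) * (pvar a * fps_nth (?d (Suc k) f) j)
          - scalar (1 / fact k) * (if a \<le> j then fps_nth (?d k f) (j - a) else 0))"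
  proof (rule sum.cong[OF refl])
    fix k
    have "scalar (1 / fact (Suc k)) * (scalar (of_nat (Suc k)) * g) = scalar (1 / fact k) * g" for g
      by (simp add: mult.assoc[symmetric] scalar_mult[symmetric] del: scalar_of_nat of_nat_Suc)
    moreover have "?d (Suc k) (pvar a * f) = fps_const (pvar a) * ?d (Suc k) f
      - fps_const (scalar (of_nat (Suc k))) * (fps_X ^ a * ?d k f)"
      using diff_series_op_power_pvar[OF assms, of k "fps_const f"] by simp
    ultimately show "scalar (1 / fact (Suc k)) * fps_nth (?d (Suc k) (pvar a * f)) j
        = scalar (1 / fact (Suc k)) * (pvar a * fps_nth (?d (Suc k) f) j)
          - scalar (1 / fact k) * (if a \<le> j then fps_nth (?d k f) (j - a) else 0)"
      by (simp add: fps_X_power_mult_nth right_diff_distrib del: scalar_of_nat of_nat_Suc)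
  qed
  also have "fps_nth (?d 0 (pvar a * f)) j = pvar a * fps_nth (?d 0 f) j"
    by simp
  also have "pvar a * fps_nth (?d 0 f) j
      + (\<Sum>k\<le>j. scalar (1 / fact (Suc k)) * (pvar a * fps_nth (?d (Suc k) f) j)
          - scalar (1 / fact k) * (if a \<le> j then fps_nth (?d k f) (j - a) else 0))
    = pvar a * (fps_nth (?d 0 f) j + (\<Sum>k\<le>j. scalar (1 / fact (Suc k)) * fps_nth (?d (Suc k) f) j))
      - (if a \<le> j then (\<Sum>k\<le>j. scalar (1 / fact k) * fps_nth (?d k f) (j - a)) else 0)"
    by (simp add: sum_subtractf sum_distrib_left distrib_left mult.left_commute)
  also have "fps_nth (?d 0 f) j + (\<Sum>k\<le>j. scalar (1 / fact (Suc k)) * fps_nth (?d (Suc k) f) j)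
      = (\<Sum>k\<le>Suc j. scalar (1 / fact k) * fps_nth (?d k f) j)"
    by (subst sum.atMost_Suc_shift) simp
  also have "\<dots> = exp_diff_coeff j f"
    by (rule exp_diff_coeff_upto[symmetric]) simp
  also have "(\<Sum>k\<le>j. scalar (1 / fact k) * fps_nth (?d k f) (j - a)) = exp_diff_coeff (j - a) f"
    by (rule exp_diff_coeff_upto[symmetric]) simp
  finally show ?thesis .
qed


text \<open>
  Indexing the $D_j$ by integers, with value 0 at negative indices, makes all the sums below
  sums over boxes, so that they may be shifted and interchanged freely.
\<close>

definition Dz :: "int \<Rightarrow> gamma \<Rightarrow> gamma" where
  "Dz j f = (if j \<ge> 0 then exp_diff_coeff (nat j) f else 0)"

lemma Dz_neg [simp]: "j < 0 \<Longrightarrow> Dz j f = 0"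
  by (simp add: Dz_def)

lemma Dz_add: "Dz j (f + g) = Dz j f + Dz j g"
  and Dz_diff: "Dz j (f - g) = Dz j f - Dz j g"
  and Dz_scalar: "Dz j (scalar c * f) = scalar c * Dz j f"
  and Dz_sum: "Dz j (sum h A) = (\<Sum>x\<in>A. Dz j (h x))"
  and Dz_0_left [simp]: "Dz 0 f = f"
  and Dz_0 [simp]: "Dz j 0 = 0"
  and Dz_1: "Dz j 1 = (if j = 0 then 1 else 0)"
  by (simp_all add: Dz_def exp_diff_coeff_add exp_diff_coeff_diff exp_diff_coeff_scalar
      exp_diff_coeff_sum exp_diff_coeff_1)

lemma Dz_pvar:
  assumes "odd a"
  shows "Dz j (pvar a * f) = pvar a * Dz j f - Dz (j - int a) f"
  using assms by (simp add: Dz_def exp_diff_coeff_pvar nat_diff_distrib' le_nat_iff)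

lemma finite_Dz_support: "finite {j. Dz j f \<noteq> 0}"
proof (rule finite_subset)
  show "{j. Dz j f \<noteq> 0} \<subseteq> int ` {j. exp_diff_coeff j f \<noteq> 0}"
  proof
    fix j assume "j \<in> {j. Dz j f \<noteq> 0}"
    then have "j = int (nat j)" "exp_diff_coeff (nat j) f \<noteq> 0"
      by (auto simp: Dz_def split: if_splits)
    then show "j \<in> int ` {j. exp_diff_coeff j f \<noteq> 0}" by blast
  qed
qed (intro finite_imageI finite_exp_diff_coeff_support)

lemma Dz_commute: "Dz i (Dz j f) = Dz j (Dz i f)"
proof (induction f arbitrary: i j rule: gamma_induct)
  case one
  show ?case by (simp add: Dz_1)
next
  case (scale c f)
  then show ?case by (simp add: Dz_scalar)
next
  case (add f g)
  then show ?case by (simp add: Dz_add)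
next
  case (pvar m f)
  then show ?case by (simp add: Dz_pvar Dz_diff)
qed

definition parity_sign :: "int \<Rightarrow> rat" where
  "parity_sign x = (if even x then 1 else -1)"

lemma parity_sign_0 [simp]: "parity_sign 0 = 1"
  by (simp add: parity_sign_def)

lemma parity_sign_add: "parity_sign (x + y) = parity_sign x * parity_sign y"
  and parity_sign_diff: "parity_sign (x - y) = parity_sign x * parity_sign y"
  and parity_sign_minus: "parity_sign (- x) = parity_sign x"
  by (auto simp: parity_sign_def)

lemma parity_sign_nat: "parity_sign (int n) = (-1) ^ n"
  by (simp add: parity_sign_def minus_one_power_iff)

text \<open>
  This is $\exp(\sum_m \partial_m w^m) \exp(-\sum_m \partial_m w^m) = 1$: all \<open>m\<close> are odd, so the
  sign change of $w$ inverts the exponential.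
\<close>

lemma Dz_inverse:
  assumes "finite A" "{0..N} \<subseteq> A"
  shows "(\<Sum>i\<in>A. scalar (parity_sign i) * Dz i (Dz (N - i) f)) = (if N = 0 then f else 0)"
  using assms
proof (induction f arbitrary: N A rule: gamma_induct)
  case one
  have "Dz i (Dz (N - i) 1) = (if i = 0 \<and> N = 0 then 1 else 0)" for i
    by (simp add: Dz_1)
  then have *: "scalar (parity_sign i) * Dz i (Dz (N - i) 1) = (if i = 0 then (if N = 0 then 1 else 0) else 0)" for i
    by simp
  show ?case
    unfolding * using one by (auto simp: sum.delta)
next
  case (scale c f)
  have "(\<Sum>i\<in>A. scalar (parity_sign i) * Dz i (Dz (N - i) (scalar c * f)))
      = scalar c * (\<Sum>i\<in>A. scalar (parity_sign i) * Dz i (Dz (N - i) f))"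
    by (simp add: Dz_scalar sum_distrib_left mult.left_commute)
  then show ?case by (simp add: scale)
next
  case (add f g)
  have "(\<Sum>i\<in>A. scalar (parity_sign i) * Dz i (Dz (N - i) (f + g)))
      = (\<Sum>i\<in>A. scalar (parity_sign i) * Dz i (Dz (N - i) f))
        + (\<Sum>i\<in>A. scalar (parity_sign i) * Dz i (Dz (N - i) g))"
    by (simp add: Dz_add sum.distrib distrib_left)
  then show ?case by (simp add: add)
next
  case (pvar a f)
  let ?S = "\<lambda>N A. \<Sum>i\<in>A. scalar (parity_sign i) * Dz i (Dz (N - i) f)"
  have inj: "inj_on (\<lambda>i. i - int a) A" by (auto simp: inj_on_def)
  have "?S (N - int a) ((\<lambda>i. i - int a) ` A)
      = (\<Sum>i\<in>A. scalar (parity_sign (i - int a)) * Dz (i - int a) (Dz (N - i) f))"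
    by (simp add: sum.reindex[OF inj])
  also have "\<dots> = - (\<Sum>i\<in>A. scalar (parity_sign i) * Dz (i - int a) (Dz (N - i) f))"
    using pvar(1) by (auto simp: parity_sign_def sum_negf[symmetric] scalar_uminus intro!: sum.cong)
  finally have shift: "(\<Sum>i\<in>A. scalar (parity_sign i) * Dz (i - int a) (Dz (N - i) f))
      = - ?S (N - int a) ((\<lambda>i. i - int a) ` A)" by simp
  have sub: "{0..N - int a} \<subseteq> (\<lambda>i. i - int a) ` A"
  proof
    fix x assume "x \<in> {0..N - int a}"
    then have "x + int a \<in> A" using pvar.prems by auto
    then show "x \<in> (\<lambda>i. i - int a) ` A" by (rule rev_image_eqI) simp
  qed
  have "(\<Sum>i\<in>A. scalar (parity_sign i) * Dz i (Dz (N - i) (pvar a * f)))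
      = pvar a * ?S N A - ?S (N - int a) A
        - (\<Sum>i\<in>A. scalar (parity_sign i) * Dz (i - int a) (Dz (N - i) f))"
    using pvar(1)
    by (simp add: Dz_pvar Dz_diff sum_subtractf sum_distrib_left right_diff_distrib
        mult.left_commute diff_diff_eq add.commute distrib_left sum.distrib)
  also have "\<dots> = pvar a * ?S N A"
    using subset_trans[of "{0..N - int a}" "{0..N}" A] pvar.prems sub by (simp add: shift pvar.IH)
  finally show ?case using pvar by simp
qed


section \<open>The multiplication operators $T^{(s)}_k$\<close>

lemma deriv_exp_series:
  assumes "fps_nth F 0 = 0"
  shows "fps_deriv (exp_series F) = fps_deriv F * exp_series F"
proof (rule fps_ext)
  fix n
  have low: "fps_nth (F ^ k) j = 0" if "j < k" for j k
    using startsby_zero_power_prefix[OF assms] that by blast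
  have upto: "fps_nth (exp_series F) j = (\<Sum>k\<le>K. scalar (1 / fact k) * fps_nth (F ^ k) j)"
    if "j \<le> K" for j K
    unfolding exp_series_def fps_nth_Abs_fps using that low
    by (intro sum.mono_neutral_left) auto
  have "fps_nth (fps_deriv (exp_series F)) n
      = of_nat (Suc n) * (\<Sum>k\<le>Suc n. scalar (1 / fact k) * fps_nth (F ^ k) (Suc n))"
    by (simp add: fps_deriv_nth upto[of _ "Suc n"] del: sum.atMost_Suc)
  also have "\<dots> = (\<Sum>k\<le>Suc n. scalar (1 / fact k) * fps_nth (fps_deriv (F ^ k)) n)"
    by (simp add: fps_deriv_nth sum_distrib_left mult.left_commute del: sum.atMost_Suc)
  also have "\<dots> = (\<Sum>k\<le>n. scalar (1 / fact (Suc k)) * fps_nth (fps_deriv (F ^ Suc k)) n)"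
    by (subst sum.atMost_Suc_shift) simp
  also have "\<dots> = (\<Sum>k\<le>n. scalar (1 / fact k) * fps_nth (fps_deriv F * F ^ k) n)"
  proof (rule sum.cong[OF refl])
    fix k
    have *: "scalar (1 / fact (Suc k)) * (scalar (of_nat (Suc k)) * g) = scalar (1 / fact k) * g" for g
      by (simp add: mult.assoc[symmetric] scalar_mult[symmetric] del: scalar_of_nat of_nat_Suc)
    have "fps_deriv (F ^ Suc k) = fps_const (scalar (of_nat (Suc k))) * (fps_deriv F * F ^ k)"
      by (simp only: fps_deriv_power scalar_of_nat diff_Suc_1 mult.assoc)
    then show "scalar (1 / fact (Suc k)) * fps_nth (fps_deriv (F ^ Suc k)) n
        = scalar (1 / fact k) * fps_nth (fps_deriv F * F ^ k) n"
      by (simp only: fps_mult_left_const_nth *)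
  qed
  also have "\<dots> = (\<Sum>k\<le>n. \<Sum>i=0..n. fps_nth (fps_deriv F) i * (scalar (1 / fact k) * fps_nth (F ^ k) (n - i)))"
    by (simp add: fps_mult_nth sum_distrib_left mult.left_commute)
  also have "\<dots> = (\<Sum>i=0..n. \<Sum>k\<le>n. fps_nth (fps_deriv F) i * (scalar (1 / fact k) * fps_nth (F ^ k) (n - i)))"
    by (rule sum.swap)
  also have "\<dots> = (\<Sum>i=0..n. fps_nth (fps_deriv F) i * fps_nth (exp_series F) (n - i))"
    by (rule sum.cong) (simp_all add: upto[of _ n] sum_distrib_left)
  finally show "fps_nth (fps_deriv (exp_series F)) n = fps_nth (fps_deriv F * exp_series F) n"
    by (simp only: fps_mult_nth)
qed

lemma T_mult_0 [simp]: "T_mult s 0 = 1"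
  by (simp add: T_mult_def exp_series_def)

lemma T_mult_recurrence:
  "of_nat k * T_mult s k = (\<Sum>m | odd m \<and> m \<le> k. 2 * pvar (s * m) * T_mult s (k - m))"
proof (cases k)
  case 0
  then have "(\<Sum>m | odd m \<and> m \<le> k. 2 * pvar (s * m) * T_mult s (k - m)) = 0"
    by (intro sum.neutral) auto
  with 0 show ?thesis by simp
next
  case (Suc n)
  define F where "F = Abs_fps (\<lambda>m. if odd m then scalar 2 * (scalar (1 / of_nat m) * pvar (s * m)) else 0)"
  have T: "T_mult s j = fps_nth (exp_series F) j" for j
    by (simp add: T_mult_def F_def)
  have coeff: "of_nat m * fps_nth F m = (if odd m then 2 * pvar (s * m) else 0)" for m
    using scalar_inverse_cancel(2)[of "of_nat m" "pvar (s * m)"]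
    by (auto simp: F_def mult.left_commute intro!: gr0I)
  have "of_nat k * T_mult s k = fps_nth (fps_deriv (exp_series F)) n"
    by (simp add: Suc T fps_deriv_nth)
  also have "\<dots> = (\<Sum>i=0..n. of_nat (Suc i) * fps_nth F (Suc i) * T_mult s (n - i))"
    by (subst deriv_exp_series) (simp_all add: F_def fps_mult_nth T)
  also have "\<dots> = (\<Sum>m=1..k. of_nat m * fps_nth F m * T_mult s (k - m))"
    by (rule sum.reindex_bij_witness[of _ "\<lambda>m. m - 1" Suc]) (auto simp: Suc)
  also have "\<dots> = (\<Sum>m | odd m \<and> m \<le> k. 2 * pvar (s * m) * T_mult s (k - m))"
    unfolding coeff by (rule sum.mono_neutral_cong_right) (auto intro!: Suc_leI gr0I)
  finally show ?thesis .
qed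

text \<open>
  Extended by 0 to negative indices for the same reason as \<open>Dz\<close>.
\<close>

definition Tz :: "nat \<Rightarrow> int \<Rightarrow> gamma" where
  "Tz s k = (if k \<ge> 0 then T_mult s (nat k) else 0)"

lemma Tz_neg [simp]: "k < 0 \<Longrightarrow> Tz s k = 0"
  by (simp add: Tz_def)

lemma Tz_0 [simp]: "Tz s 0 = 1"
  by (simp add: Tz_def)

lemma Tz_nat: "Tz s (int k) = T_mult s k"
  by (simp add: Tz_def)

lemma Tz_nonneg: "Tz s k \<noteq> 0 \<Longrightarrow> k \<ge> 0"
  by (simp add: Tz_def split: if_splits)

lemma Tz_recurrence:
  assumes "k \<le> int K"
  shows "scalar (of_int k) * Tz s k
    = (\<Sum>m | odd m \<and> m \<le> K. 2 * pvar (s * m) * Tz s (k - int m))"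
proof (cases "k \<ge> 0")
  case True
  then obtain n where n: "k = int n" by (metis nonneg_int_cases)
  have "scalar (of_int k) * Tz s k = (\<Sum>m | odd m \<and> m \<le> n. 2 * pvar (s * m) * T_mult s (n - m))"
    by (simp add: n Tz_nat T_mult_recurrence)
  also have "\<dots> = (\<Sum>m | odd m \<and> m \<le> n. 2 * pvar (s * m) * Tz s (k - int m))"
    by (rule sum.cong) (auto simp: n Tz_nat simp flip: of_nat_diff)
  also have "\<dots> = (\<Sum>m | odd m \<and> m \<le> K. 2 * pvar (s * m) * Tz s (k - int m))"
    using n assms by (intro sum.mono_neutral_left) (auto dest: Tz_nonneg)
  finally show ?thesis .
qed (auto simp: not_le)

text \<open>The coefficients of $(1-x)/(1+x)$.\<close>

definition acoef :: "nat \<Rightarrow> rat" where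
  "acoef i = (if i = 0 then 1 else 2 * (-1) ^ i)"

lemma acoef_0 [simp]: "acoef 0 = 1"
  by (simp add: acoef_def)

text \<open>
  The equation $x a'(x) = -\frac{2x}{1-x^2} a(x)$ for $a(x) = (1-x)/(1+x)$.
\<close>

lemma acoef_recurrence: "of_nat t * acoef t = - (\<Sum>m | odd m \<and> m \<le> t. 2 * acoef (t - m))"
proof -
  have *: "(\<Sum>l\<le>t. if odd (t - l) then acoef l else 0) = - of_nat t * (-1) ^ t" for t
  proof (induction t rule: induct_nat_012)
    case (ge2 t)
    have "(\<Sum>l\<le>t. if odd (Suc (Suc t) - l) then acoef l else 0)
        = (\<Sum>l\<le>t. if odd (t - l) then acoef l else 0)"
      by (rule sum.cong) auto
    then show ?case using ge2 by (simp add: acoef_def algebra_simps)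
  qed (simp_all add: acoef_def)
  have "(\<Sum>m | odd m \<and> m \<le> t. acoef (t - m)) = (\<Sum>m\<le>t. if odd m then acoef (t - m) else 0)"
    by (rule sum.mono_neutral_cong_left) auto
  also have "\<dots> = (\<Sum>l\<le>t. if odd (t - l) then acoef l else 0)"
    by (rule sum.reindex_bij_witness[of _ "\<lambda>l. t - l" "\<lambda>l. t - l"]) auto
  finally show ?thesis
    using *[of t] by (simp add: acoef_def sum_distrib_left[symmetric])
qed

text \<open>
  The generating series of the \<open>T\<close> is an exponential of the power sums, on which the translation
  $p_{sm} \mapsto p_{sm} - w^{sm}$ acts by the factor
  $\exp(-2 \sum_{m\ \mathrm{odd}} (u w^s)^m / m) = (1 - u w^s) / (1 + u w^s)$. The recurrences of
  both sides in the exponent of $u$ agree.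
\<close>

lemma Dz_T_mult:
  assumes "odd s"
  shows "Dz j (T_mult s k * g)
    = (\<Sum>i\<le>k. scalar (acoef i) * (Tz s (int k - int i) * Dz (j - int (s * i)) g))"
proof (induction k arbitrary: j rule: less_induct)
  case (less k)
  show ?case
  proof (cases "k = 0")
    case True
    then show ?thesis by simp
  next
    case False
    let ?O = "{m. odd m \<and> m \<le> k}"
    define X where "X t = Tz s (int k - int t) * Dz (j - int (s * t)) g" for t
    have [simp]: "finite ?O" by simp
    have IH: "Dz j' (T_mult s (k - m) * g)
        = (\<Sum>i\<le>k. scalar (acoef i) * (Tz s (int k - int m - int i) * Dz (j' - int (s * i)) g))"
      if "m \<in> ?O" for m j'
    proof -
      have "k - m < k" using that False by (auto elim: oddE)
      then have "Dz j' (T_mult s (k - m) * g)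
        = (\<Sum>i\<le>k - m. scalar (acoef i) * (Tz s (int k - int m - int i) * Dz (j' - int (s * i)) g))"
        using that by (simp add: less.IH of_nat_diff)
      also have "\<dots> = (\<Sum>i\<le>k. scalar (acoef i) * (Tz s (int k - int m - int i) * Dz (j' - int (s * i)) g))"
      proof (rule sum.mono_neutral_left)
        show "\<forall>i\<in>{..k} - {..k - m}. scalar (acoef i) * (Tz s (int k - int m - int i) * Dz (j' - int (s * i)) g) = 0"
        proof
          fix i assume "i \<in> {..k} - {..k - m}"
          then have "Tz s (int k - int m - int i) = 0" by (intro Tz_neg) auto
          then show "scalar (acoef i) * (Tz s (int k - int m - int i) * Dz (j' - int (s * i)) g) = 0"
            by simp
        qed
      qed auto
      finally show ?thesis .
    qed
    have "of_nat k * Dz j (T_mult s k * g) = Dz j (of_nat k * T_mult s k * g)"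
      using Dz_scalar[of j "of_nat k" "T_mult s k * g"] by (simp add: mult.assoc)
    also have "\<dots> = Dz j (\<Sum>m\<in>?O. scalar 2 * (pvar (s * m) * (T_mult s (k - m) * g)))"
      by (simp add: T_mult_recurrence sum_distrib_right mult.assoc)
    also have "\<dots> = (\<Sum>m\<in>?O. scalar 2 * (pvar (s * m) * Dz j (T_mult s (k - m) * g)))
        - (\<Sum>m\<in>?O. scalar 2 * Dz (j - int (s * m)) (T_mult s (k - m) * g))"
      using assms by (simp only: Dz_sum Dz_scalar) (simp add: Dz_pvar right_diff_distrib sum_subtractf)
    finally have split: "of_nat k * Dz j (T_mult s k * g)
      = (\<Sum>m\<in>?O. scalar 2 * (pvar (s * m) * Dz j (T_mult s (k - m) * g)))
        - (\<Sum>m\<in>?O. scalar 2 * Dz (j - int (s * m)) (T_mult s (k - m) * g))" .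
    have "(\<Sum>m\<in>?O. scalar 2 * (pvar (s * m) * Dz j (T_mult s (k - m) * g)))
        = (\<Sum>m\<in>?O. \<Sum>i\<le>k. scalar (acoef i) *
            (2 * pvar (s * m) * Tz s (int k - int i - int m) * Dz (j - int (s * i)) g))"
      using IH by (intro sum.cong refl) (simp add: sum_distrib_left algebra_simps)
    also have "\<dots> = (\<Sum>i\<le>k. scalar (acoef i) *
            ((\<Sum>m\<in>?O. 2 * pvar (s * m) * Tz s (int k - int i - int m)) * Dz (j - int (s * i)) g))"
      by (subst sum.swap) (simp add: sum_distrib_left sum_distrib_right)
    also have "\<dots> = (\<Sum>i\<le>k. scalar (acoef i) *
            (scalar (of_int (int k - int i)) * Tz s (int k - int i) * Dz (j - int (s * i)) g))"
      by (subst Tz_recurrence[symmetric]) simp_all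
    also have "\<dots> = (\<Sum>i\<le>k. scalar (of_nat k - of_nat i) * (scalar (acoef i) * X i))"
      by (simp add: X_def mult_ac)
    finally have part1: "(\<Sum>m\<in>?O. scalar 2 * (pvar (s * m) * Dz j (T_mult s (k - m) * g)))
        = (\<Sum>i\<le>k. scalar (of_nat k - of_nat i) * (scalar (acoef i) * X i))" .
    have "(\<Sum>m\<in>?O. scalar 2 * Dz (j - int (s * m)) (T_mult s (k - m) * g))
        = (\<Sum>m\<in>?O. \<Sum>i\<le>k. scalar 2 * (scalar (acoef i) * X (m + i)))"
      using IH by (intro sum.cong refl) (simp add: X_def sum_distrib_left algebra_simps)
    also have "\<dots> = (\<Sum>m\<le>k. \<Sum>i\<le>k. if odd m then scalar 2 * (scalar (acoef i) * X (m + i)) else 0)"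
      by (rule sum.mono_neutral_cong_left) auto
    also have "\<dots> = (\<Sum>(m, i)\<in>{..k} \<times> {..k}. if odd m then scalar 2 * (scalar (acoef i) * X (m + i)) else 0)"
      by (rule sum.cartesian_product)
    also have "\<dots> = (\<Sum>(m, i)\<in>{(m, i). m + i \<le> k}. if odd m then scalar 2 * (scalar (acoef i) * X (m + i)) else 0)"
    proof (rule sum.mono_neutral_right)
      show "\<forall>x\<in>{..k} \<times> {..k} - {(m, i). m + i \<le> k}.
          (case x of (m, i) \<Rightarrow> if odd m then scalar 2 * (scalar (acoef i) * X (m + i)) else 0) = 0"
      proof
        fix x assume "x \<in> {..k} \<times> {..k} - {(m, i). m + i \<le> k}"
        then obtain m i where x: "x = (m, i)" and "\<not> m + i \<le> k" by (cases x) auto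
        then have "X (m + i) = 0" by (simp add: X_def)
        then show "(case x of (m, i) \<Rightarrow> if odd m then scalar 2 * (scalar (acoef i) * X (m + i)) else 0) = 0"
          by (simp add: x)
      qed
    qed auto
    also have "\<dots> = (\<Sum>t\<le>k. \<Sum>m\<le>t. if odd m then scalar 2 * (scalar (acoef (t - m)) * X t) else 0)"
      by (subst sum.triangle_reindex_eq) (auto intro!: sum.cong)
    also have "\<dots> = (\<Sum>t\<le>k. scalar (\<Sum>m | odd m \<and> m \<le> t. 2 * acoef (t - m)) * X t)"
    proof (rule sum.cong[OF refl])
      fix t
      have "(\<Sum>m\<le>t. if odd m then scalar 2 * (scalar (acoef (t - m)) * X t) else 0)
          = (\<Sum>m | odd m \<and> m \<le> t. scalar 2 * (scalar (acoef (t - m)) * X t))"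
        by (rule sum.mono_neutral_cong_right) auto
      also have "\<dots> = scalar (\<Sum>m | odd m \<and> m \<le> t. 2 * acoef (t - m)) * X t"
        by (simp add: scalar_sum sum_distrib_right scalar_mult mult.assoc)
      finally show "(\<Sum>m\<le>t. if odd m then scalar 2 * (scalar (acoef (t - m)) * X t) else 0)
        = scalar (\<Sum>m | odd m \<and> m \<le> t. 2 * acoef (t - m)) * X t" .
    qed
    also have "\<dots> = - (\<Sum>t\<le>k. scalar (of_nat t) * (scalar (acoef t) * X t))"
      by (simp only: sum_negf[symmetric] mult_minus_left[symmetric] mult.assoc[symmetric]
          scalar_mult[symmetric] scalar_uminus[symmetric] acoef_recurrence minus_minus)
    finally have "of_nat k * Dz j (T_mult s k * g)
      = (\<Sum>i\<le>k. scalar (of_nat k - of_nat i) * (scalar (acoef i) * X i))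
        + (\<Sum>i\<le>k. scalar (of_nat i) * (scalar (acoef i) * X i))"
      by (simp only: split part1 diff_minus_eq_add)
    also have "\<dots> = of_nat k * (\<Sum>i\<le>k. scalar (acoef i) * X i)"
      by (simp add: sum.distrib[symmetric] sum_distrib_left scalar_diff left_diff_distrib)
    finally have "of_nat k * Dz j (T_mult s k * g) = of_nat k * (\<Sum>i\<le>k. scalar (acoef i) * X i)" .
    then show ?thesis
      unfolding X_def by (rule of_nat_cancel[rotated]) (use False in simp)
  qed
qed


section \<open>Commutation relations of the vertex operators\<close>

lemma q_series_nth: "fps_nth q_series n = T_mult 1 n"
proof -
  have "scalar (2 / of_nat m) = scalar 2 * scalar (1 / of_nat m)" for m
    by (simp only: scalar_mult[symmetric]) simp
  then show ?thesis
    by (simp add: q_series_def T_mult_def mult.assoc del: scalar_numeral cong: if_cong)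
qed

text \<open>
  The index set is left free so that it can be shifted along with the index, or shared by several
  polynomials.
\<close>

lemma Q_op_eq_sum:
  assumes "finite A" "{j. Dz j f \<noteq> 0} \<subseteq> A"
  shows "Q_op m f = (\<Sum>j\<in>A. Tz 1 (m + j) * Dz j f)"
proof -
  have "Q_op m f = (\<Sum>j | m + int j \<ge> 0 \<and> exp_diff_coeff j f \<noteq> 0. Tz 1 (m + int j) * Dz (int j) f)"
    unfolding Q_op_def by (rule sum.cong) (auto simp: q_series_nth Tz_def Dz_def)
  also have "\<dots> = (\<Sum>j\<in>int ` {j. m + int j \<ge> 0 \<and> exp_diff_coeff j f \<noteq> 0}. Tz 1 (m + j) * Dz j f)"
    by (simp add: sum.reindex)
  also have "\<dots> = (\<Sum>j\<in>A. Tz 1 (m + j) * Dz j f)"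
  proof (rule sum.mono_neutral_left)
    show "int ` {j. m + int j \<ge> 0 \<and> exp_diff_coeff j f \<noteq> 0} \<subseteq> A"
      using assms(2) by (auto simp: Dz_def)
    show "\<forall>j\<in>A - int ` {j. m + int j \<ge> 0 \<and> exp_diff_coeff j f \<noteq> 0}. Tz 1 (m + j) * Dz j f = 0"
    proof
      fix j assume j: "j \<in> A - int ` {j. m + int j \<ge> 0 \<and> exp_diff_coeff j f \<noteq> 0}"
      show "Tz 1 (m + j) * Dz j f = 0"
      proof (cases "j < 0 \<or> m + j < 0")
        case False
        then have "j = int (nat j)" "m + int (nat j) \<ge> 0" by auto
        with j have "exp_diff_coeff (nat j) f = 0" by blast
        then show ?thesis by (simp add: Dz_def)
      qed auto
    qed
  qed fact
  finally show ?thesis .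
qed

lemma Q_op_add: "Q_op m (f + g) = Q_op m f + Q_op m g"
proof -
  let ?A = "{j. Dz j f \<noteq> 0} \<union> {j. Dz j g \<noteq> 0}"
  have "finite ?A" by (simp add: finite_Dz_support)
  moreover have "{j. Dz j (f + g) \<noteq> 0} \<subseteq> ?A" by (auto simp: Dz_add)
  ultimately show ?thesis
    by (simp add: Q_op_eq_sum[of ?A] Dz_add distrib_left sum.distrib)
qed

lemma Q_op_scalar: "Q_op m (scalar c * f) = scalar c * Q_op m f"
proof -
  have "{j. Dz j (scalar c * f) \<noteq> 0} \<subseteq> {j. Dz j f \<noteq> 0}" by (auto simp: Dz_scalar)
  then show ?thesis
    by (simp add: Q_op_eq_sum[of "{j. Dz j f \<noteq> 0}"] finite_Dz_support Dz_scalar sum_distrib_left mult.left_commute)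
qed

lemma Q_op_0 [simp]: "Q_op m 0 = 0"
  using Q_op_scalar[of m 0 0] by simp

lemma Q_op_sum: "Q_op m (sum h A) = (\<Sum>x\<in>A. Q_op m (h x))"
  by (induction A rule: infinite_finite_induct) (auto simp: Q_op_add)

lemma Q_op_1: "Q_op m 1 = Tz 1 m"
  by (subst Q_op_eq_sum[of "{0}"]) (auto simp: Dz_1)

text \<open>
  In generating series:
  $Q(z) T(u) = \frac{1 - u z^{-s}}{1 + u z^{-s}}\, T(u) Q(z)$, because only the derivatives
  in $Q(z)$ see $T(u)$.
\<close>

lemma Q_op_T_mult:
  assumes "odd s"
  shows "Q_op m (T_mult s k * g)
    = (\<Sum>i\<le>k. scalar (acoef i) * (Tz s (int k - int i) * Q_op (m + int (s * i)) g))"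
proof -
  define A where "A = {j. Dz j (T_mult s k * g) \<noteq> 0} \<union> (\<Union>i\<le>k. (\<lambda>j. j + int (s * i)) ` {j. Dz j g \<noteq> 0})"
  have A: "finite A"
    by (auto simp: A_def finite_Dz_support)
  have "Q_op m (T_mult s k * g) = (\<Sum>j\<in>A. Tz 1 (m + j) * Dz j (T_mult s k * g))"
    using A by (rule Q_op_eq_sum) (auto simp: A_def)
  also have "\<dots> = (\<Sum>j\<in>A. \<Sum>i\<le>k. scalar (acoef i) * (Tz s (int k - int i) *
      (Tz 1 (m + j) * Dz (j - int (s * i)) g)))"
    by (simp add: Dz_T_mult[OF assms] sum_distrib_left mult.left_commute)
  also have "\<dots> = (\<Sum>i\<le>k. scalar (acoef i) * (Tz s (int k - int i) *
      (\<Sum>j\<in>A. Tz 1 (m + j) * Dz (j - int (s * i)) g)))"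
    by (subst sum.swap) (simp add: sum_distrib_left)
  also have "\<dots> = (\<Sum>i\<le>k. scalar (acoef i) * (Tz s (int k - int i) * Q_op (m + int (s * i)) g))"
  proof (rule sum.cong[OF refl])
    fix i assume i: "i \<in> {..k}"
    let ?B = "(\<lambda>j. j - int (s * i)) ` A"
    have "{j. Dz j g \<noteq> 0} \<subseteq> ?B"
    proof
      fix j assume "j \<in> {j. Dz j g \<noteq> 0}"
      then have "j + int (s * i) \<in> A" using i by (auto simp: A_def)
      then show "j \<in> ?B" by (rule rev_image_eqI) simp
    qed
    then have "Q_op (m + int (s * i)) g = (\<Sum>j\<in>?B. Tz 1 (m + int (s * i) + j) * Dz j g)"
      using A by (intro Q_op_eq_sum) auto
    also have "\<dots> = (\<Sum>j\<in>A. Tz 1 (m + j) * Dz (j - int (s * i)) g)"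
      by (subst sum.reindex) (auto simp: inj_on_def algebra_simps)
    finally show "scalar (acoef i) * (Tz s (int k - int i) * (\<Sum>j\<in>A. Tz 1 (m + j) * Dz (j - int (s * i)) g))
        = scalar (acoef i) * (Tz s (int k - int i) * Q_op (m + int (s * i)) g)"
      by simp
  qed
  finally show ?thesis .
qed

text \<open>This is $q(z) q(-z) = 1$ for the series $q(z) = \sum_n q_n z^n$.\<close>

lemma q_inverse_nat:
  "(\<Sum>p\<le>t. scalar ((-1) ^ p) * (T_mult 1 p * T_mult 1 (t - p))) = (if t = 0 then 1 else 0)"
proof (cases "t = 0")
  case False
  let ?O = "{m. odd m \<and> m \<le> t}"
  define q where "q = Tz 1"
  define h where "h N = (\<Sum>p\<in>{0..int t}. scalar (parity_sign p) * (q p * q (N - p)))" for N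
  have rec: "scalar (of_int N) * q N = (\<Sum>m\<in>?O. 2 * pvar m * q (N - int m))" if "N \<le> int t" for N
    using Tz_recurrence[OF that, of 1] by (simp add: q_def)
  have shift: "(\<Sum>p\<in>{0..int t}. scalar (parity_sign p) * (q (p - int m) * q (int t - p)))
      = - h (int t - int m)" if "odd m" "m \<le> t" for m
  proof -
    have "(\<Sum>p\<in>{0..int t}. scalar (parity_sign p) * (q (p - int m) * q (int t - p)))
        = (\<Sum>p\<in>{int m..int t}. scalar (parity_sign p) * (q (p - int m) * q (int t - p)))"
      by (rule sum.mono_neutral_right) (auto simp: q_def)
    also have "\<dots> = (\<Sum>p\<in>{0..int t - int m}. scalar (parity_sign (p + int m)) * (q p * q (int t - int m - p)))"
      by (rule sum.reindex_bij_witness[of _ "\<lambda>p. p + int m" "\<lambda>p. p - int m"]) (auto simp: algebra_simps)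
    also have "\<dots> = (\<Sum>p\<in>{0..int t - int m}. - (scalar (parity_sign p) * (q p * q (int t - int m - p))))"
      using that by (intro sum.cong refl) (auto simp: parity_sign_def scalar_uminus)
    also have "\<dots> = - h (int t - int m)"
      unfolding h_def sum_negf by (subst sum.mono_neutral_left[of "{0..int t}"]) (auto simp: q_def)
    finally show ?thesis .
  qed
  \<comment> \<open>Split $t = p + (t - p)$ and apply the recurrence to one factor in each half. A shift of $p$
    by the odd number $m$ changes the sign, so the two halves cancel.\<close>
  have "of_nat t * h (int t)
      = (\<Sum>p\<in>{0..int t}. scalar (parity_sign p) * (scalar (of_int p) * q p * q (int t - p)))
        + (\<Sum>p\<in>{0..int t}. scalar (parity_sign p) * (q p * (scalar (of_int (int t - p)) * q (int t - p))))"
    by (simp add: h_def sum.distrib[symmetric] sum_distrib_left scalar_diff algebra_simps)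
  also have "(\<Sum>p\<in>{0..int t}. scalar (parity_sign p) * (scalar (of_int p) * q p * q (int t - p)))
      = (\<Sum>p\<in>{0..int t}. \<Sum>m\<in>?O. 2 * pvar m * (scalar (parity_sign p) * (q (p - int m) * q (int t - p))))"
    by (intro sum.cong refl) (subst rec, simp,
        simp add: sum_distrib_left sum_distrib_right mult_ac)
  also have "\<dots> = (\<Sum>m\<in>?O. 2 * pvar m * (\<Sum>p\<in>{0..int t}. scalar (parity_sign p) * (q (p - int m) * q (int t - p))))"
    by (subst sum.swap) (simp add: sum_distrib_left)
  also have "\<dots> = (\<Sum>m\<in>?O. 2 * pvar m * - h (int t - int m))"
    by (intro sum.cong refl) (simp add: shift)
  also have "(\<Sum>p\<in>{0..int t}. scalar (parity_sign p) * (q p * (scalar (of_int (int t - p)) * q (int t - p))))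
      = (\<Sum>p\<in>{0..int t}. \<Sum>m\<in>?O. 2 * pvar m * (scalar (parity_sign p) * (q p * q (int t - int m - p))))"
    by (intro sum.cong refl) (subst rec, simp,
        simp add: sum_distrib_left sum_distrib_right mult_ac diff_diff_eq add.commute)
  also have "\<dots> = (\<Sum>m\<in>?O. 2 * pvar m * h (int t - int m))"
    unfolding h_def by (subst sum.swap) (simp add: sum_distrib_left)
  finally have "of_nat t * h (int t) = of_nat t * 0"
    by (simp add: sum_negf)
  then have "h (int t) = 0"
    by (rule of_nat_cancel[rotated]) (use False in simp)
  also have "h (int t) = (\<Sum>p\<le>t. scalar ((-1) ^ p) * (T_mult 1 p * T_mult 1 (t - p)))"
    unfolding h_def
    by (rule sum.reindex_bij_witness[of _ int nat])
      (auto simp: q_def Tz_nat parity_sign_nat Tz_def nat_diff_distrib' simp flip: parity_sign_nat)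
  finally show ?thesis using False by simp
qed simp

lemma q_inverse:
  assumes "finite A" "{0..N} \<subseteq> A"
  shows "(\<Sum>p\<in>A. scalar (parity_sign p) * (Tz 1 p * Tz 1 (N - p))) = (if N = 0 then 1 else 0)"
proof -
  have "(\<Sum>p\<in>A. scalar (parity_sign p) * (Tz 1 p * Tz 1 (N - p)))
      = (\<Sum>p\<in>{0..N}. scalar (parity_sign p) * (Tz 1 p * Tz 1 (N - p)))"
  proof (rule sum.mono_neutral_right)
    show "\<forall>p\<in>A - {0..N}. scalar (parity_sign p) * (Tz 1 p * Tz 1 (N - p)) = 0"
    proof
      fix p assume "p \<in> A - {0..N}"
      then have "p < 0 \<or> N - p < 0" by auto
      then show "scalar (parity_sign p) * (Tz 1 p * Tz 1 (N - p)) = 0" by auto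
    qed
  qed (use assms in auto)
  also have "\<dots> = (if N = 0 then 1 else 0)"
  proof (cases "N \<ge> 0")
    case True
    then obtain t where N: "N = int t" by (metis nonneg_int_cases)
    have "(\<Sum>p\<in>{0..N}. scalar (parity_sign p) * (Tz 1 p * Tz 1 (N - p)))
        = (\<Sum>p\<le>t. scalar ((-1) ^ p) * (T_mult 1 p * T_mult 1 (t - p)))"
      unfolding N by (rule sum.reindex_bij_witness[of _ int nat])
        (auto simp: Tz_def nat_diff_distrib' simp flip: parity_sign_nat)
    then show ?thesis using q_inverse_nat[of t] N by simp
  qed simp
  finally show ?thesis .
qed

text \<open>
  The first sum is the coefficient of $z^x w^y$ in $\frac{z-w}{z+w} q(z) q(w)$ expanded in powers of
  $w/z$, the second one that of $\frac{w-z}{w+z} q(w) q(z)$ expanded in powers of $z/w$. The rational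
  functions are opposite, so only the difference of the two expansions remains, a delta function at
  $z = -w$, where $q(z) q(w) = 1$.
\<close>

lemma q_pair_relation:
  assumes "x \<le> int K" "y \<le> int K"
  shows "(\<Sum>l\<le>K. scalar (acoef l) * (Tz 1 (x + int l) * Tz 1 (y - int l)))
      + (\<Sum>l\<le>K. scalar (acoef l) * (Tz 1 (y + int l) * Tz 1 (x - int l)))
    = scalar (if x + y = 0 then 2 * parity_sign x else 0)"
proof -
  let ?g = "\<lambda>l. Tz 1 (x + l) * Tz 1 (y - l)"
  let ?c = "\<lambda>l. scalar (acoef (nat \<bar>l\<bar>))"
  have "(\<Sum>l\<le>K. scalar (acoef l) * ?g (int l)) = (\<Sum>l\<in>{0..int K}. ?c l * ?g l)"
    by (rule sum.reindex_bij_witness[of _ nat int]) auto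
  moreover have "(\<Sum>l\<le>K. scalar (acoef l) * (Tz 1 (y + int l) * Tz 1 (x - int l)))
      = (\<Sum>l\<in>{-int K..0}. ?c l * ?g l)"
    by (rule sum.reindex_bij_witness[of _ "\<lambda>l. nat (- l)" "\<lambda>l. - int l"]) (auto simp: mult.commute)
  ultimately have "(\<Sum>l\<le>K. scalar (acoef l) * ?g (int l))
      + (\<Sum>l\<le>K. scalar (acoef l) * (Tz 1 (y + int l) * Tz 1 (x - int l)))
      = (\<Sum>l\<in>{0..int K}. ?c l * ?g l) + (\<Sum>l\<in>{-int K..0}. ?c l * ?g l)"
    by simp
  also have "(\<Sum>l\<in>{0..int K}. ?c l * ?g l) + (\<Sum>l\<in>{-int K..0}. ?c l * ?g l)
      = (\<Sum>l\<in>{-int K..int K}. (if l \<ge> 0 then ?c l * ?g l else 0))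
        + (\<Sum>l\<in>{-int K..int K}. (if l \<le> 0 then ?c l * ?g l else 0))"
    by (intro arg_cong2[of _ _ _ _ "(+)"] sum.mono_neutral_cong_left) auto
  also have "\<dots> = (\<Sum>l\<in>{-int K..int K}. scalar (2 * parity_sign l) * ?g l)"
    unfolding sum.distrib[symmetric]
  proof (rule sum.cong[OF refl])
    fix l :: int
    have "parity_sign l = (-1) ^ nat \<bar>l\<bar>"
      by (simp add: parity_sign_nat[symmetric] parity_sign_def)
    then show "(if l \<ge> 0 then ?c l * ?g l else 0) + (if l \<le> 0 then ?c l * ?g l else 0)
        = scalar (2 * parity_sign l) * ?g l"
      by (cases "l = 0") (auto simp: acoef_def)
  qed
  also have "\<dots> = (\<Sum>p\<in>{x - int K..x + int K}. scalar (2 * parity_sign x) *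
      (scalar (parity_sign p) * (Tz 1 p * Tz 1 (x + y - p))))"
  proof -
    have "2 * parity_sign x * parity_sign (x + l) = 2 * parity_sign l" for l
      by (auto simp: parity_sign_def)
    then have "scalar (2 * parity_sign x) * (scalar (parity_sign (x + l)) * h) = scalar (2 * parity_sign l) * h" for l h
      by (simp only: mult.assoc[symmetric] scalar_mult[symmetric])
    then show ?thesis
      by (intro sum.reindex_bij_witness[of _ "\<lambda>p. p - x" "\<lambda>l. x + l"]) auto
  qed
  also have "\<dots> = scalar (2 * parity_sign x) * (if x + y = 0 then 1 else 0)"
    unfolding sum_distrib_left[symmetric]
    by (subst q_inverse) (use assms in auto)
  finally show ?thesis by simp
qed

text \<open>
  In $Q_m Q_n f$ the outer translation acts on the inner factor $q_{n+j}$ by \<open>Q_op_T_mult\<close>. Since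
  the $D_j$ commute, the anticommutator is a combination of the $D_i D_j f$ with the coefficients of
  \<open>q_pair_relation\<close>, which survive only for $i + j = -(m + n)$ and are then, up to a constant,
  $(-1)^i$. Their sum is evaluated by \<open>Dz_inverse\<close>.
\<close>

theorem Q_op_anticommute:
  "Q_op m (Q_op n f) + Q_op n (Q_op m f)
    = scalar (if m + n = 0 then 2 * parity_sign m else 0) * f"
proof -
  define A where "A = {j. Dz j f \<noteq> 0} \<union> (\<Union>i\<in>{j. Dz j f \<noteq> 0}. {j. Dz j (Dz i f) \<noteq> 0})"
  have finA: "finite A"
    by (auto simp: A_def finite_Dz_support)
  have D1: "{j. Dz j f \<noteq> 0} \<subseteq> A" by (auto simp: A_def)
  have D2: "{i. Dz i (Dz j f) \<noteq> 0} \<subseteq> A" for j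
    by (cases "Dz j f = 0") (auto simp: A_def)
  obtain K where K: "\<And>j x. j \<in> A \<Longrightarrow> x \<in> {m, n} \<Longrightarrow> x + j \<le> int K"
  proof -
    define S where "S = insert 0 ((\<lambda>j. m + j) ` A \<union> (\<lambda>j. n + j) ` A)"
    have S: "finite S" "0 \<in> S" using finA by (auto simp: S_def)
    show thesis
    proof (rule that[of "nat (Max S)"])
      fix j x assume "j \<in> A" "x \<in> {m, n}"
      then have "x + j \<in> S" by (auto simp: S_def)
      then have "x + j \<le> Max S" using S by simp
      moreover have "0 \<le> Max S" using S by simp
      ultimately show "x + j \<le> int (nat (Max S))" by simp
    qed
  qed
  define B where "B x y = (\<Sum>l\<le>K. scalar (acoef l) * (Tz 1 (x + int l) * Tz 1 (y - int l)))" for x y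
  have Q_Tz: "Q_op x (Tz 1 y * g) = (\<Sum>l\<le>K. scalar (acoef l) * (Tz 1 (y - int l) * Q_op (x + int l) g))"
    if "y \<le> int K" for x y g
  proof (cases "y \<ge> 0")
    case True
    then obtain k where k: "y = int k" by (metis nonneg_int_cases)
    have "Q_op x (Tz 1 y * g) = (\<Sum>l\<le>k. scalar (acoef l) * (Tz 1 (y - int l) * Q_op (x + int l) g))"
      using Q_op_T_mult[of 1 x k g] by (simp add: k Tz_nat)
    also have "\<dots> = (\<Sum>l\<le>K. scalar (acoef l) * (Tz 1 (y - int l) * Q_op (x + int l) g))"
      using that by (intro sum.mono_neutral_left) (auto simp: k)
    finally show ?thesis .
  qed simp
  have QQ: "Q_op x (Q_op y f) = (\<Sum>j\<in>A. \<Sum>i\<in>A. B (x + i) (y + j) * Dz i (Dz j f))"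
    if "x \<in> {m, n}" "y \<in> {m, n}" for x y
  proof -
    have "Q_op x (Q_op y f) = (\<Sum>j\<in>A. Q_op x (Tz 1 (y + j) * Dz j f))"
      by (simp add: Q_op_eq_sum[OF finA D1, of y] Q_op_sum)
    also have "\<dots> = (\<Sum>j\<in>A. \<Sum>l\<le>K. scalar (acoef l) * (Tz 1 (y + j - int l) *
        (\<Sum>i\<in>A. Tz 1 (x + int l + i) * Dz i (Dz j f))))"
    proof (rule sum.cong[OF refl])
      fix j assume "j \<in> A"
      then have "y + j \<le> int K" using K that by blast
      then show "Q_op x (Tz 1 (y + j) * Dz j f) = (\<Sum>l\<le>K. scalar (acoef l) * (Tz 1 (y + j - int l) *
        (\<Sum>i\<in>A. Tz 1 (x + int l + i) * Dz i (Dz j f))))"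
        by (simp add: Q_Tz Q_op_eq_sum[OF finA D2] del: One_nat_def)
    qed
    also have "\<dots> = (\<Sum>j\<in>A. \<Sum>l\<le>K. \<Sum>i\<in>A. scalar (acoef l) * (Tz 1 (x + i + int l) *
        Tz 1 (y + j - int l)) * Dz i (Dz j f))"
      by (simp add: sum_distrib_left mult_ac add_ac)
    also have "\<dots> = (\<Sum>j\<in>A. \<Sum>i\<in>A. B (x + i) (y + j) * Dz i (Dz j f))"
      by (intro sum.cong refl, subst sum.swap) (simp add: B_def sum_distrib_right)
    finally show ?thesis .
  qed
  have "Q_op n (Q_op m f) = (\<Sum>j\<in>A. \<Sum>i\<in>A. B (n + j) (m + i) * Dz i (Dz j f))"
    by (subst QQ, simp, simp, subst sum.swap) (simp add: Dz_commute)
  then have "Q_op m (Q_op n f) + Q_op n (Q_op m f)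
      = (\<Sum>j\<in>A. \<Sum>i\<in>A. (B (m + i) (n + j) + B (n + j) (m + i)) * Dz i (Dz j f))"
    by (simp add: QQ sum.distrib distrib_right)
  also have "\<dots> = (\<Sum>j\<in>A. \<Sum>i\<in>A. scalar (if m + i + (n + j) = 0 then 2 * parity_sign (m + i) else 0) * Dz i (Dz j f))"
    unfolding B_def using K by (intro sum.cong refl) (subst q_pair_relation, auto)
  also have "\<dots> = (\<Sum>i\<in>A. \<Sum>j\<in>A. if j = - (m + n) - i then scalar (2 * parity_sign (m + i)) * Dz i (Dz j f) else 0)"
    by (subst sum.swap) (intro sum.cong refl, auto)
  also have "\<dots> = (\<Sum>i\<in>A. scalar (2 * parity_sign (m + i)) * Dz i (Dz (- (m + n) - i) f))"
  proof (intro sum.cong refl)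
    fix i
    show "(\<Sum>j\<in>A. if j = - (m + n) - i then scalar (2 * parity_sign (m + i)) * Dz i (Dz j f) else 0)
        = scalar (2 * parity_sign (m + i)) * Dz i (Dz (- (m + n) - i) f)"
    proof (cases "- (m + n) - i \<in> A")
      case False
      then have "Dz (- (m + n) - i) f = 0" using D1 by blast
      then show ?thesis using finA False by (simp add: sum.delta)
    qed (use finA in \<open>simp add: sum.delta\<close>)
  qed
  also have "\<dots> = scalar (2 * parity_sign m) * (\<Sum>i\<in>A. scalar (parity_sign i) * Dz i (Dz (- (m + n) - i) f))"
    by (simp only: parity_sign_add mult.assoc[symmetric] scalar_mult sum_distrib_left)
  also have "(\<Sum>i\<in>A. scalar (parity_sign i) * Dz i (Dz (- (m + n) - i) f))
      = (\<Sum>i\<in>A \<union> {0..- (m + n)}. scalar (parity_sign i) * Dz i (Dz (- (m + n) - i) f))"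
    using finA D2 by (intro sum.mono_neutral_left) auto
  also have "\<dots> = (if - (m + n) = 0 then f else 0)"
    using finA by (intro Dz_inverse) auto
  finally show ?thesis
    by (auto simp: add_eq_0_iff)
qed


section \<open>The vacuum expectation\<close>

definition eps :: "gamma \<Rightarrow> rat" where
  "eps f = Poly_Mapping.lookup f 0"

lemma eps_add: "eps (f + g) = eps f + eps g"
  and eps_minus: "eps (- f) = - eps f"
  and eps_diff: "eps (f - g) = eps f - eps g"
  and eps_0 [simp]: "eps 0 = 0"
  and eps_1 [simp]: "eps 1 = 1"
  by (simp_all add: eps_def lookup_add lookup_minus)

lemma eps_sum: "eps (sum h A) = (\<Sum>x\<in>A. eps (h x))"
  by (induction A rule: infinite_finite_induct) (auto simp: eps_add)

lemma eps_scalar: "eps (scalar c * f) = c * eps f"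
proof (induction f rule: poly_mapping_single_induct)
  case (add_single f a b)
  then show ?case
    by (auto simp: distrib_left eps_add scalar_def mult_single) (auto simp: eps_def lookup_single when_def)
qed simp

lemma eps_pvar [simp]: "eps (pvar m * f) = 0"
proof (induction f rule: poly_mapping_single_induct)
  case (add_single f a b)
  let ?e = "Poly_Mapping.single (m div 2) (1 :: nat) + a"
  have "Poly_Mapping.lookup ?e (m div 2) \<noteq> 0" by (simp add: lookup_add)
  then have "?e \<noteq> 0" by (metis lookup_zero)
  then have "eps (pvar m * Poly_Mapping.single a b) = 0"
    by (simp add: pvar_def mult_single eps_def lookup_single)
  with add_single show ?case by (simp add: distrib_left eps_add)
qed simp

lemma eps_mult: "eps (f * g) = eps f * eps g"
proof (induction f rule: gamma_induct)
  case (scale c f)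
  then show ?case by (simp add: mult.assoc eps_scalar)
next
  case (add f h)
  then show ?case by (simp add: distrib_right eps_add)
next
  case (pvar m f)
  then show ?case by (simp add: mult.assoc)
qed simp

lemma eps_T_mult: "eps (T_mult s k) = (if k = 0 then 1 else 0)"
proof (cases "k = 0")
  case False
  have "rat_of_nat k * eps (T_mult s k) = eps (of_nat k * T_mult s k)"
    using eps_scalar[of "of_nat k"] by simp
  also have "\<dots> = 0"
    using eps_pvar[of _ 1] by (simp add: T_mult_recurrence eps_sum eps_mult)
  finally show ?thesis using False by simp
qed simp

lemma eps_Tz: "eps (Tz s k) = (if k = 0 then 1 else 0)"
  by (auto simp: Tz_def eps_T_mult)

lemma eps_Q_op: "eps (Q_op m f) = eps (Dz (- m) f)"
proof -
  let ?A = "insert (- m) {j. Dz j f \<noteq> 0}"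
  have "eps (Q_op m f) = (\<Sum>j\<in>?A. eps (Tz 1 (m + j)) * eps (Dz j f))"
    by (subst Q_op_eq_sum[of ?A]) (auto simp: finite_Dz_support eps_sum eps_mult)
  also have "\<dots> = (\<Sum>j\<in>?A. if j = - m then eps (Dz j f) else 0)"
    by (rule sum.cong) (auto simp: eps_Tz add_eq_0_iff)
  also have "\<dots> = eps (Dz (- m) f)"
    by (subst sum.delta) (auto simp: finite_Dz_support)
  finally show ?thesis .
qed

lemma eps_Q_op_pos: "m > 0 \<Longrightarrow> eps (Q_op m f) = 0"
  and eps_Q_op_0: "eps (Q_op 0 f) = eps f"
  by (simp_all add: eps_Q_op)

lemma Q_op_neg_1: "m < 0 \<Longrightarrow> Q_op m 1 = 0"
  and Q_op_0_1: "Q_op 0 1 = 1"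
  by (simp_all add: Q_op_1)


section \<open>The Schur Q-functions span\<close>

text \<open>
  The bound on the parts allows a larger part to be put in front of every term of a combination at
  once, which is what the straightening needs after an anticommutation.
\<close>

inductive Q_span :: "int \<Rightarrow> gamma \<Rightarrow> bool" for N where
  zero: "Q_span N 0"
| add_term: "strict_partition lam \<Longrightarrow> \<forall>x\<in>set lam. int x < N \<Longrightarrow> Q_span N f
    \<Longrightarrow> Q_span N (scalar c * Q_fun lam + f)"

lemma Q_fun_Nil [simp]: "Q_fun [] = 1"
  and Q_fun_Cons [simp]: "Q_fun (m # lam) = Q_op (int m) (Q_fun lam)"
  by (simp_all add: Q_fun_def)

lemma strict_partition_Nil [simp]: "strict_partition []"
  by (simp add: strict_partition_def)

lemma strict_partition_Cons:
  "strict_partition (l # lam) \<longleftrightarrow> l > 0 \<and> (\<forall>x\<in>set lam. x < l) \<and> strict_partition lam"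
  by (auto simp: strict_partition_def)

lemma Q_span_add: "Q_span N f \<Longrightarrow> Q_span N g \<Longrightarrow> Q_span N (f + g)"
  by (induction rule: Q_span.induct) (auto simp: add.assoc intro: Q_span.intros)

lemma Q_span_scalar: "Q_span N f \<Longrightarrow> Q_span N (scalar c * f)"
proof (induction rule: Q_span.induct)
  case (add_term lam f d)
  then show ?case
    using Q_span.add_term[of lam N "scalar c * f" "c * d"]
    by (simp add: distrib_left scalar_mult mult.assoc)
qed (simp add: Q_span.zero)

lemma Q_span_diff: "Q_span N f \<Longrightarrow> Q_span N g \<Longrightarrow> Q_span N (f - g)"
  using Q_span_add[of N f "scalar (-1) * g"] Q_span_scalar[of N g "-1"]
  by (simp add: scalar_uminus)

lemma Q_span_base:
  assumes "strict_partition lam" "\<forall>x\<in>set lam. int x < N"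
  shows "Q_span N (Q_fun lam)"
  using Q_span.add_term[OF assms Q_span.zero, of 1] by simp

lemma Q_span_mono: "Q_span N f \<Longrightarrow> N \<le> N' \<Longrightarrow> Q_span N' f"
  by (induction rule: Q_span.induct) (auto intro!: Q_span.intros)

lemma Q_span_prepend:
  assumes "Q_span (int l) f" "l > 0" "int l < N"
  shows "Q_span N (Q_op (int l) f)"
  using assms(1)
proof (induction rule: Q_span.induct)
  case (add_term lam f c)
  have "Q_span N (scalar c * Q_fun (l # lam) + Q_op (int l) f)"
    using add_term assms by (intro Q_span.add_term) (auto simp: strict_partition_Cons)
  then show ?case by (simp add: Q_op_add Q_op_scalar)
qed (simp add: Q_span.zero)

text \<open>
  Straightening: a factor $Q_m$ in front of $Q_\lambda$ is moved to its place by anticommutation.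
  The scalars that appear multiply shorter words, and $Q_m^2 = 0$ for $m > 0$.
\<close>

lemma Q_span_straighten:
  assumes "strict_partition lam" "\<forall>x\<in>set lam. int x < N" "m < N"
  shows "Q_span N (Q_op m (Q_fun lam))"
  using assms
proof (induction lam arbitrary: m N)
  case Nil
  show ?case
  proof (cases m "0 :: int" rule: linorder_cases)
    case less
    then show ?thesis by (simp add: Q_op_neg_1 Q_span.zero)
  next
    case equal
    then show ?thesis using Q_span_base[of "[]"] by (simp add: Q_op_0_1)
  next
    case greater
    then show ?thesis
      using Q_span_base[of "[nat m]" N] Nil by (simp add: strict_partition_Cons)
  qed
next
  case (Cons l lam)
  have l: "l > 0" "int l < N" and lam: "strict_partition lam" "\<forall>x\<in>set lam. int x < int l"
    using Cons.prems by (auto simp: strict_partition_Cons)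
  show ?case
  proof (cases m "int l" rule: linorder_cases)
    case less
    have "Q_span N (scalar (if m + int l = 0 then 2 * parity_sign m else 0) * Q_fun lam
        - Q_op (int l) (Q_op m (Q_fun lam)))"
      using lam l less
      by (intro Q_span_diff Q_span_scalar Q_span_base Q_span_prepend Cons.IH) auto
    then show ?thesis
      by (simp add: Q_op_anticommute[of m "int l" "Q_fun lam", symmetric])
  next
    case equal
    have "of_nat 2 * Q_op m (Q_op m (Q_fun lam)) = of_nat 2 * 0"
      using Q_op_anticommute[of m m "Q_fun lam"] equal l by (simp flip: mult_2)
    then have "Q_op m (Q_op m (Q_fun lam)) = 0"
      by (rule of_nat_cancel[rotated]) simp
    then show ?thesis using equal by (simp add: Q_span.zero)
  next
    case greater
    then show ?thesis
      using Q_span_base[of "nat m # l # lam" N] Cons.prems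
      by (fastforce simp: strict_partition_Cons)
  qed
qed

definition in_Q_span :: "gamma \<Rightarrow> bool" where
  "in_Q_span f \<longleftrightarrow> (\<exists>N. Q_span N f)"

lemma in_Q_span_0: "in_Q_span 0"
  and in_Q_span_1: "in_Q_span 1"
  using Q_span.zero Q_span_base[of "[]"] by (auto simp: in_Q_span_def)

lemma in_Q_span_add: "in_Q_span f \<Longrightarrow> in_Q_span g \<Longrightarrow> in_Q_span (f + g)"
  unfolding in_Q_span_def by (meson Q_span_add Q_span_mono max.cobounded1 max.cobounded2)

lemma in_Q_span_scalar: "in_Q_span f \<Longrightarrow> in_Q_span (scalar c * f)"
  unfolding in_Q_span_def by (meson Q_span_scalar)

lemma in_Q_span_diff: "in_Q_span f \<Longrightarrow> in_Q_span g \<Longrightarrow> in_Q_span (f - g)"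
  using in_Q_span_add[of f "scalar (-1) * g"] in_Q_span_scalar[of g "-1"]
  by (simp add: scalar_uminus)

lemma in_Q_span_sum: "(\<And>x. x \<in> A \<Longrightarrow> in_Q_span (h x)) \<Longrightarrow> in_Q_span (sum h A)"
  by (induction A rule: infinite_finite_induct) (auto simp: in_Q_span_add in_Q_span_0)

lemma in_Q_span_Q_op: "in_Q_span f \<Longrightarrow> in_Q_span (Q_op m f)"
proof -
  assume "in_Q_span f"
  then obtain N where "Q_span N f" by (auto simp: in_Q_span_def)
  then have "Q_span (max N (m + 1)) (Q_op m f)"
  proof (induction rule: Q_span.induct)
    case (add_term lam f c)
    then have "Q_span (max N (m + 1)) (Q_op m (Q_fun lam))"
      by (intro Q_span_straighten) auto
    with add_term show ?case
      by (auto simp: Q_op_add Q_op_scalar intro: Q_span_add Q_span_scalar)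
  qed (simp add: Q_span.zero)
  then show ?thesis by (auto simp: in_Q_span_def)
qed

text \<open>
  The term with $i = 0$ in the commutation relation for $Q_m T^{(1)}_k$ is $T^{(1)}_k Q_m$; all others
  have a smaller index of $T^{(1)}$.
\<close>

lemma in_Q_span_T_mult_Q_op:
  assumes "\<And>k. in_Q_span (T_mult 1 k * g)"
  shows "in_Q_span (T_mult 1 k * Q_op m g)"
proof (induction k arbitrary: m rule: less_induct)
  case (less k)
  have "Q_op m (T_mult 1 k * g) = T_mult 1 k * Q_op m g
      + (\<Sum>i\<in>{1..k}. scalar (acoef i) * (T_mult 1 (k - i) * Q_op (m + int i) g))"
    by (subst Q_op_T_mult)
      (auto simp: atMost_atLeast0 sum.atLeast_Suc_atMost Tz_def nat_diff_distrib' intro!: sum.cong)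
  then have "T_mult 1 k * Q_op m g = Q_op m (T_mult 1 k * g)
      - (\<Sum>i\<in>{1..k}. scalar (acoef i) * (T_mult 1 (k - i) * Q_op (m + int i) g))"
    by simp
  also have "in_Q_span \<dots>"
    by (intro in_Q_span_diff in_Q_span_Q_op assms in_Q_span_sum in_Q_span_scalar less) auto
  finally show ?case .
qed

lemma in_Q_span_T_mult:
  assumes "in_Q_span f"
  shows "in_Q_span (T_mult 1 k * f)"
proof -
  have *: "in_Q_span (T_mult 1 k * Q_fun lam)" for lam k
  proof (induction lam arbitrary: k)
    case Nil
    show ?case
      using in_Q_span_Q_op[OF in_Q_span_1, of "int k"] by (simp add: Q_op_1 Tz_nat del: One_nat_def)
  next
    case (Cons m lam)
    then show ?case using in_Q_span_T_mult_Q_op[of "Q_fun lam" k "int m"] by simp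
  qed
  from assms obtain N where "Q_span N f" by (auto simp: in_Q_span_def)
  then show ?thesis
  proof (induction rule: Q_span.induct)
    case (add_term lam f c)
    then show ?case
      by (auto simp: distrib_left mult.left_commute[of "T_mult _ _" "scalar _"]
          intro!: in_Q_span_add in_Q_span_scalar * simp del: One_nat_def)
  qed (simp add: in_Q_span_0)
qed

text \<open>
  The recurrence of the $q_n$ expresses $2 p_n$ by $q_n$ and products $p_m q_{n-m}$ with $m < n$.
\<close>

lemma in_Q_span_pvar:
  assumes "odd n" "in_Q_span f"
  shows "in_Q_span (pvar n * f)"
  using assms
proof (induction n arbitrary: f rule: less_induct)
  case (less n)
  let ?O = "{m. odd m \<and> m < n}"
  have eq: "{m. odd m \<and> m \<le> n} = insert n ?O"
    using less.prems by auto
  have "of_nat n * T_mult 1 n = 2 * pvar n + (\<Sum>m\<in>?O. 2 * pvar m * T_mult 1 (n - m))"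
    using T_mult_recurrence[of n 1] unfolding eq by simp
  then have "scalar 2 * (pvar n * f) = scalar (of_nat n) * (T_mult 1 n * f)
      - (\<Sum>m\<in>?O. scalar 2 * (pvar m * (T_mult 1 (n - m) * f)))"
    by (simp add: mult.assoc[symmetric] distrib_right sum_distrib_right del: One_nat_def)
  also have "in_Q_span \<dots>"
    using less by (intro in_Q_span_diff in_Q_span_scalar in_Q_span_sum in_Q_span_T_mult less.IH) auto
  finally have "in_Q_span (scalar (1/2) * (scalar 2 * (pvar n * f)))"
    by (rule in_Q_span_scalar)
  then show ?case by (simp only: scalar_inverse_cancel(1)[of 2, simplified] scalar_inverse_cancel)
qed

theorem in_Q_span: "in_Q_span f"
  by (induction f rule: gamma_induct)
    (auto intro: in_Q_span_1 in_Q_span_scalar in_Q_span_add in_Q_span_pvar)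

text \<open>
  With respect to the inner product for which $p_m$ is adjoint to
  $\frac{m}{2} \partial/\partial p_m$, the adjoint of $Q_m$ is $(-1)^m Q_{-m}$, and
  \<open>pairing \<lambda> f\<close> is the inner product of $Q_\lambda$ with \<open>f\<close>.
\<close>

definition Q_adj :: "nat \<Rightarrow> gamma \<Rightarrow> gamma" where
  "Q_adj m f = scalar (parity_sign (int m)) * Q_op (- int m) f"

definition pairing :: "nat list \<Rightarrow> gamma \<Rightarrow> rat" where
  "pairing lam f = eps (fold Q_adj lam f)"

lemma Q_adj_add: "Q_adj m (f + g) = Q_adj m f + Q_adj m g"
  and Q_adj_scalar: "Q_adj m (scalar c * f) = scalar c * Q_adj m f"
  by (simp_all add: Q_adj_def Q_op_add Q_op_scalar distrib_left mult.left_commute)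

lemma fold_Q_adj_add: "fold Q_adj lam (f + g) = fold Q_adj lam f + fold Q_adj lam g"
  by (induction lam arbitrary: f g) (auto simp: Q_adj_add)

lemma fold_Q_adj_scalar: "fold Q_adj lam (scalar c * f) = scalar c * fold Q_adj lam f"
  by (induction lam arbitrary: f) (auto simp: Q_adj_scalar)

lemma fold_Q_adj_0 [simp]: "fold Q_adj lam 0 = 0"
  using fold_Q_adj_scalar[of lam 0 0] by simp

lemma pairing_add: "pairing lam (f + g) = pairing lam f + pairing lam g"
  and pairing_scalar: "pairing lam (scalar c * f) = c * pairing lam f"
  and pairing_0 [simp]: "pairing lam 0 = 0"
  by (simp_all add: pairing_def fold_Q_adj_add eps_add fold_Q_adj_scalar eps_scalar)

lemma Q_adj_Q_op_neq:
  assumes "l \<noteq> n"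
  shows "Q_adj l (Q_op (int n) g) = - Q_op (int n) (Q_adj l g)"
  using Q_op_anticommute[of "- int l" "int n" g] assms
  by (simp add: Q_adj_def Q_op_scalar eq_neg_iff_add_eq_0[symmetric])

lemma Q_adj_Q_fun_notin: "l > 0 \<Longrightarrow> l \<notin> set nu \<Longrightarrow> Q_adj l (Q_fun nu) = 0"
proof (induction nu)
  case Nil
  then show ?case by (simp add: Q_adj_def Q_op_neg_1)
qed (simp add: Q_adj_Q_op_neq)

lemma Q_adj_Q_op_same:
  assumes "l > 0" "l \<notin> set nu"
  shows "Q_adj l (Q_op (int l) (Q_fun nu)) = scalar 2 * Q_fun nu"
proof -
  let ?s = "scalar (parity_sign (int l))"
  have "?s * Q_op (- int l) (Q_op (int l) (Q_fun nu))
      = ?s * (scalar (2 * parity_sign (int l)) * Q_fun nu) - ?s * Q_op (int l) (Q_op (- int l) (Q_fun nu))"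
    using Q_op_anticommute[of "- int l" "int l" "Q_fun nu"]
    by (simp add: right_diff_distrib[symmetric] parity_sign_minus eq_diff_eq)
  also have "?s * Q_op (int l) (Q_op (- int l) (Q_fun nu)) = Q_op (int l) (Q_adj l (Q_fun nu))"
    by (simp add: Q_adj_def Q_op_scalar)
  also have "\<dots> = 0" using assms by (simp add: Q_adj_Q_fun_notin)
  also have "?s * (scalar (2 * parity_sign (int l)) * Q_fun nu) = scalar 2 * Q_fun nu"
  proof -
    have "parity_sign (int l) * (2 * parity_sign (int l)) = 2"
      by (simp add: parity_sign_def)
    then show ?thesis by (simp only: mult.assoc[symmetric] scalar_mult[symmetric])
  qed
  finally show ?thesis by (simp add: Q_adj_def)
qed

lemma fold_Q_adj_Q_op:
  assumes "n \<notin> set lam"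
  shows "fold Q_adj lam (Q_op (int n) g) = scalar ((-1) ^ length lam) * Q_op (int n) (fold Q_adj lam g)"
  using assms
proof (induction lam arbitrary: g)
  case (Cons l lam)
  then have "fold Q_adj (l # lam) (Q_op (int n) g) = fold Q_adj lam (scalar (-1) * Q_op (int n) (Q_adj l g))"
    by (simp add: Q_adj_Q_op_neq scalar_uminus)
  also have "\<dots> = scalar (-1) * (scalar ((-1) ^ length lam) * Q_op (int n) (fold Q_adj lam (Q_adj l g)))"
    using Cons by (simp only: fold_Q_adj_scalar) simp
  finally show ?case by (simp add: scalar_uminus)
qed simp

text \<open>
  On the strict $Q_\nu$, the operator $Q_l^*$ is up to sign twice the removal of a part \<open>l\<close>, and 0 if \<open>l\<close> is
  not a part of $\nu$. If the largest part of $\nu$ exceeds that of $\lambda$, it can be moved to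
  the left of all the adjoints, where \<open>eps\<close> annihilates it.
\<close>

lemma pairing_Q_fun:
  assumes "strict_partition lam" "strict_partition nu"
  shows "pairing lam (Q_fun nu) = (if lam = nu then 2 ^ length lam else 0)"
  using assms
proof (induction lam arbitrary: nu)
  case Nil
  then show ?case
    by (cases nu) (auto simp: pairing_def eps_Q_op_pos strict_partition_Cons)
next
  case (Cons l lam)
  show ?case
  proof (cases nu)
    case Nil
    then show ?thesis
      using Cons.prems Q_adj_Q_fun_notin[of l "[]"] by (simp add: pairing_def strict_partition_Cons)
  next
    case (Cons n nu')
    have l: "l > 0" "strict_partition lam" and n: "n > 0" "strict_partition nu'"
      using Cons.prems \<open>nu = n # nu'\<close> by (auto simp: strict_partition_Cons)
    show ?thesis
    proof (cases l n rule: linorder_cases)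
      case less
      then have "n \<notin> set (l # lam)" using Cons.prems by (auto simp: strict_partition_Cons)
      then have "pairing (l # lam) (Q_fun nu) = 0"
        using n fold_Q_adj_Q_op[of n "l # lam" "Q_fun nu'"]
        by (simp add: pairing_def Cons eps_scalar eps_Q_op_pos)
      then show ?thesis using less Cons by simp
    next
      case equal
      have "l \<notin> set nu'" using Cons.prems Cons equal by (auto simp: strict_partition_Cons)
      then have "pairing (l # lam) (Q_fun nu) = pairing lam (scalar 2 * Q_fun nu')"
        using l equal Cons by (simp add: pairing_def Q_adj_Q_op_same)
      then show ?thesis using equal Cons Cons.IH[of nu'] l n by (simp only: pairing_scalar) simp
    next
      case greater
      then have "l \<notin> set nu" using Cons.prems Cons by (auto simp: strict_partition_Cons)
      then show ?thesis
        using greater Cons l Q_adj_Q_fun_notin[of l nu] by (simp add: pairing_def)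
    qed
  qed
qed

text \<open>
  Some finite combination of the $Q_\lambda$ equals \<open>f\<close>, and the pairings read off its
  coefficients. The set \<open>S\<close> may miss terms of that combination, but only such with coefficient 0.
\<close>

theorem Q_fun_expansion:
  assumes S: "finite S" "\<And>lam. lam \<in> S \<Longrightarrow> strict_partition lam"
    and supp: "\<And>lam. strict_partition lam \<Longrightarrow> lam \<notin> S \<Longrightarrow> pairing lam f = 0"
  shows "f = (\<Sum>lam\<in>S. scalar (pairing lam f / 2 ^ length lam) * Q_fun lam)"
proof -
  let ?P = "\<lambda>S f. finite S \<longrightarrow> (\<forall>lam\<in>S. strict_partition lam)
      \<longrightarrow> f = (\<Sum>lam\<in>S. scalar (pairing lam f / 2 ^ length lam) * Q_fun lam)"
  obtain N where "Q_span N f"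
    using in_Q_span[of f] by (auto simp: in_Q_span_def)
  then have "\<exists>S0. finite S0 \<and> (\<forall>lam\<in>S0. strict_partition lam) \<and> (\<forall>S. S0 \<subseteq> S \<longrightarrow> ?P S f)"
  proof (induction rule: Q_span.induct)
    case zero
    show ?case by (intro exI[of _ "{}"]) simp
  next
    case (add_term lam f c)
    then obtain S0 where S0: "finite S0" "\<forall>lam\<in>S0. strict_partition lam" "\<forall>S. S0 \<subseteq> S \<longrightarrow> ?P S f"
      by blast
    have "?P S (scalar c * Q_fun lam + f)" if "insert lam S0 \<subseteq> S" for S
    proof (intro impI)
      assume S: "finite S" "\<forall>lam\<in>S. strict_partition lam"
      have "(\<Sum>nu\<in>S. scalar (pairing nu (scalar c * Q_fun lam + f) / 2 ^ length nu) * Q_fun nu)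
          = (\<Sum>nu\<in>S. scalar (c * pairing nu (Q_fun lam) / 2 ^ length nu) * Q_fun nu)
            + (\<Sum>nu\<in>S. scalar (pairing nu f / 2 ^ length nu) * Q_fun nu)"
        by (simp add: pairing_add pairing_scalar add_divide_distrib scalar_add distrib_right sum.distrib)
      also have "(\<Sum>nu\<in>S. scalar (pairing nu f / 2 ^ length nu) * Q_fun nu) = f"
        using S0 S that by auto
      also have "(\<Sum>nu\<in>S. scalar (c * pairing nu (Q_fun lam) / 2 ^ length nu) * Q_fun nu)
          = (\<Sum>nu\<in>S. if nu = lam then scalar c * Q_fun lam else 0)"
        using S add_term.hyps by (intro sum.cong refl) (auto simp: pairing_Q_fun)
      also have "\<dots> = scalar c * Q_fun lam"
        using S that by simp
      finally show "scalar c * Q_fun lam + f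
          = (\<Sum>nu\<in>S. scalar (pairing nu (scalar c * Q_fun lam + f) / 2 ^ length nu) * Q_fun nu)" ..
    qed
    then show ?case
      using S0 add_term.hyps by (intro exI[of _ "insert lam S0"]) auto
  qed
  then obtain S0 where S0: "finite S0" "\<forall>lam\<in>S0. strict_partition lam" "\<forall>S. S0 \<subseteq> S \<longrightarrow> ?P S f"
    by blast
  have "f = (\<Sum>lam\<in>S \<union> S0. scalar (pairing lam f / 2 ^ length lam) * Q_fun lam)"
    using S0 S by blast
  also have "\<dots> = (\<Sum>lam\<in>S. scalar (pairing lam f / 2 ^ length lam) * Q_fun lam)"
    using S S0 supp by (intro sum.mono_neutral_right) auto
  finally show ?thesis .
qed


section \<open>Pfaffians\<close>

text \<open>
  The Pfaffian before division by $2^n n!$. The matrix is a function on all pairs of numbers, so that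
  passing to a minor is composition with a map of indices.
\<close>

definition pf_term :: "nat \<Rightarrow> (nat \<Rightarrow> nat \<Rightarrow> rat) \<Rightarrow> (nat \<Rightarrow> nat) \<Rightarrow> rat" where
  "pf_term n A \<sigma> = of_int (sign \<sigma>) * (\<Prod>i<n. A (\<sigma> (2 * i)) (\<sigma> (2 * i + 1)))"

definition pf_sum :: "nat \<Rightarrow> (nat \<Rightarrow> nat \<Rightarrow> rat) \<Rightarrow> rat" where
  "pf_sum n A = (\<Sum>\<sigma> | \<sigma> permutes {..<2 * n}. pf_term n A \<sigma>)"

lemma pf_term_swap_pair:
  assumes anti: "\<And>i j. A j i = - A i j" and q: "q < n" and \<sigma>: "\<sigma> permutes {..<2 * n}"
  shows "pf_term n A (\<sigma> \<circ> transpose (2 * q) (2 * q + 1)) = pf_term n A \<sigma>"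
proof -
  let ?t = "transpose (2 * q) (2 * q + 1)"
  have perm: "permutation \<sigma>" unfolding permutation_permutes using \<sigma> by blast
  have sgn: "sign (\<sigma> \<circ> ?t) = - sign \<sigma>"
    using perm by (simp add: sign_compose permutation_swap_id sign_swap_id)
  have "(\<Prod>i<n. A ((\<sigma> \<circ> ?t) (2 * i)) ((\<sigma> \<circ> ?t) (2 * i + 1)))
      = (\<Prod>i<n. (if i = q then -1 else 1) * A (\<sigma> (2 * i)) (\<sigma> (2 * i + 1)))"
  proof (rule prod.cong[OF refl])
    fix i
    show "A ((\<sigma> \<circ> ?t) (2 * i)) ((\<sigma> \<circ> ?t) (2 * i + 1))
      = (if i = q then -1 else 1) * A (\<sigma> (2 * i)) (\<sigma> (2 * i + 1))"
    proof (cases "i = q")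
      case True
      then show ?thesis using anti[of "\<sigma> (2 * q)" "\<sigma> (2 * q + 1)"] by simp
    next
      case False
      then have "?t (2 * i) = 2 * i" "?t (2 * i + 1) = 2 * i + 1"
        by (auto simp: transpose_def)
      then show ?thesis using False by simp
    qed
  qed
  also have "\<dots> = - (\<Prod>i<n. A (\<sigma> (2 * i)) (\<sigma> (2 * i + 1)))"
    using q by (simp add: prod.distrib prod.delta)
  finally have flip: "(\<Prod>i<n. A ((\<sigma> \<circ> ?t) (2 * i)) ((\<sigma> \<circ> ?t) (2 * i + 1)))
      = - (\<Prod>i<n. A (\<sigma> (2 * i)) (\<sigma> (2 * i + 1)))" .
  show ?thesis unfolding pf_term_def sgn flip by simp
qed

lemma pf_term_swap_blocks:
  assumes q: "0 < q" "q < n" and \<sigma>: "\<sigma> permutes {..<2 * n}"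
  shows "pf_term n A (\<sigma> \<circ> (transpose 0 (2 * q) \<circ> transpose 1 (2 * q + 1))) = pf_term n A \<sigma>"
proof -
  let ?t = "transpose 0 (2 * q) \<circ> transpose 1 (2 * q + 1)"
  have perm: "permutation \<sigma>" unfolding permutation_permutes using \<sigma> by blast
  have sgn: "sign (\<sigma> \<circ> ?t) = sign \<sigma>"
    using perm q by (simp add: sign_compose permutation_compose permutation_swap_id sign_swap_id)
  have pos: "?t (2 * i) = 2 * transpose 0 q i" "?t (2 * i + 1) = 2 * transpose 0 q i + 1" for i
    using q by (auto simp: transpose_def)
  have "(\<Prod>i<n. A ((\<sigma> \<circ> ?t) (2 * i)) ((\<sigma> \<circ> ?t) (2 * i + 1)))
      = (\<Prod>i<n. A (\<sigma> (2 * transpose 0 q i)) (\<sigma> (2 * transpose 0 q i + 1)))"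
    using pos by (simp only: o_apply)
  also have "\<dots> = (\<Prod>i<n. A (\<sigma> (2 * i)) (\<sigma> (2 * i + 1)))"
  proof -
    have "transpose 0 q permutes {..<n}"
      using q by (intro permutes_swap_id) auto
    from prod.permute[OF this, of "\<lambda>i. A (\<sigma> (2 * i)) (\<sigma> (2 * i + 1))"]
    show ?thesis by (simp add: o_def)
  qed
  finally have same: "(\<Prod>i<n. A ((\<sigma> \<circ> ?t) (2 * i)) ((\<sigma> \<circ> ?t) (2 * i + 1)))
      = (\<Prod>i<n. A (\<sigma> (2 * i)) (\<sigma> (2 * i + 1)))" .
  show ?thesis unfolding pf_term_def sgn same ..
qed

lemma pf_sum_reposition:
  assumes t: "t permutes {..<2 * n}" "t \<circ> t = id"
    and inv: "\<And>\<sigma>. \<sigma> permutes {..<2 * n} \<Longrightarrow> pf_term n A (\<sigma> \<circ> t) = pf_term n A \<sigma>"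
  shows "(\<Sum>\<sigma> | \<sigma> permutes {..<2 * n} \<and> \<sigma> (t p) = 0. pf_term n A \<sigma>)
    = (\<Sum>\<sigma> | \<sigma> permutes {..<2 * n} \<and> \<sigma> p = 0. pf_term n A \<sigma>)"
proof -
  have tt: "t (t x) = x" for x
    using t(2) by (metis comp_apply id_apply)
  have cancel: "\<sigma> \<circ> t \<circ> t = \<sigma>" for \<sigma> :: "nat \<Rightarrow> nat"
    using t(2) by (simp add: comp_assoc)
  show ?thesis
    by (rule sum.reindex_bij_witness[of _ "\<lambda>\<sigma>. \<sigma> \<circ> t" "\<lambda>\<sigma>. \<sigma> \<circ> t"])
      (auto simp: cancel inv tt permutes_compose[OF t(1)])
qed

text \<open>
  The position of the index 0 does not matter: exchanging the two entries of a factor changes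
  the sign of the permutation and of the factor, and exchanging two factors is an even
  permutation of the positions.
\<close>

lemma pf_sum_first:
  assumes anti: "\<And>i j. A j i = - A i j" and n: "n > 0"
  shows "pf_sum n A = 2 * of_nat n * (\<Sum>\<sigma> | \<sigma> permutes {..<2 * n} \<and> \<sigma> 0 = 0. pf_term n A \<sigma>)"
proof -
  let ?S = "\<lambda>p. \<Sum>\<sigma> | \<sigma> permutes {..<2 * n} \<and> \<sigma> p = 0. pf_term n A \<sigma>"
  have even: "?S (2 * q) = ?S 0" if "q < n" for q
  proof (cases "q = 0")
    case False
    let ?t = "transpose 0 (2 * q) \<circ> transpose 1 (2 * q + 1)"
    have "?S (?t 0) = ?S 0"
    proof (rule pf_sum_reposition[where t = ?t and p = 0])
      show "?t permutes {..<2 * n}"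
        using that by (intro permutes_compose permutes_swap_id) auto
      show "?t \<circ> ?t = id"
        using False by (auto simp: transpose_def fun_eq_iff)
      show "pf_term n A (\<sigma> \<circ> ?t) = pf_term n A \<sigma>" if "\<sigma> permutes {..<2 * n}" for \<sigma>
        using False \<open>q < n\<close> that by (intro pf_term_swap_blocks) auto
    qed
    moreover have "?t 0 = 2 * q" using False by (simp add: transpose_def)
    ultimately show ?thesis by simp
  qed simp
  have odd: "?S (2 * q + 1) = ?S (2 * q)" if "q < n" for q
  proof -
    let ?t = "transpose (2 * q) (2 * q + 1)"
    have "?S (?t (2 * q)) = ?S (2 * q)"
    proof (rule pf_sum_reposition[where t = ?t and p = "2 * q"])
      show "?t permutes {..<2 * n}"
        using that by (intro permutes_swap_id) auto
      show "pf_term n A (\<sigma> \<circ> ?t) = pf_term n A \<sigma>" if "\<sigma> permutes {..<2 * n}" for \<sigma>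
        using anti \<open>q < n\<close> that by (rule pf_term_swap_pair)
    qed simp
    then show ?thesis by simp
  qed
  have all: "?S p = ?S 0" if "p < 2 * n" for p
  proof (cases "even p")
    case True
    then show ?thesis using even[of "p div 2"] that by auto
  next
    case False
    then obtain q where "p = 2 * q + 1" by (elim oddE)
    then show ?thesis using even[of q] odd[of q] that by simp
  qed
  have "pf_sum n A = (\<Sum>\<sigma> | \<sigma> permutes {..<2 * n}. \<Sum>p<2 * n. if \<sigma> p = 0 then pf_term n A \<sigma> else 0)"
    unfolding pf_sum_def
  proof (rule sum.cong[OF refl])
    fix \<sigma> assume "\<sigma> \<in> {\<sigma>. \<sigma> permutes {..<2 * n}}"
    then have \<sigma>: "\<sigma> permutes {..<2 * n}" by simp
    have "\<sigma> p = 0 \<longleftrightarrow> p = inv_into UNIV \<sigma> 0" for p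
      using \<sigma> by (metis permutes_inverses)
    moreover have "inv_into UNIV \<sigma> 0 < 2 * n"
      using permutes_in_image[OF permutes_inv[OF \<sigma>], of 0] n by simp
    ultimately show "pf_term n A \<sigma> = (\<Sum>p<2 * n. if \<sigma> p = 0 then pf_term n A \<sigma> else 0)"
      by simp
  qed
  also have "\<dots> = (\<Sum>p<2 * n. \<Sum>\<sigma> | \<sigma> permutes {..<2 * n}. if \<sigma> p = 0 then pf_term n A \<sigma> else 0)"
    by (rule sum.swap)
  also have "\<dots> = (\<Sum>p<2 * n. ?S p)"
    by (rule sum.cong[OF refl], rule sum.mono_neutral_cong_right) (auto simp: finite_permutations)
  also have "\<dots> = (\<Sum>p<2 * n. ?S 0)"
    by (rule sum.cong[OF refl], rule all) simp
  finally show ?thesis by simp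
qed

text \<open>
  A permutation with $0 \mapsto 0$, $1 \mapsto j + 1$ is a permutation of the remaining indices,
  relabelled; the relabelling is a cycle of length $j + 1$.
\<close>

lemma pf_term_insert:
  assumes \<rho>: "\<rho> permutes {0..<2 * n}" and j: "j < Suc (2 * n)"
  shows "pf_term (Suc n) A (permutation_insert 0 0 (permutation_insert 0 j \<rho>))
    = (-1) ^ j * A 0 (Suc j) *
      pf_term n (\<lambda>a b. A (Suc (insert_index j a)) (Suc (insert_index j b))) \<rho>"
proof -
  let ?\<tau> = "permutation_insert 0 j \<rho>"
  let ?\<sigma> = "permutation_insert 0 0 ?\<tau>"
  have \<tau>: "?\<tau> permutes {0..<Suc (2 * n)}"
    using \<rho> j by (intro permutation_insert_permutes) auto
  have "of_int (sign ?\<sigma>) = (of_int (sign ?\<tau>) :: rat)"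
    using signof_permutation_insert[OF \<tau>, of 0 0, where ?'a = rat] by simp
  also have "\<dots> = (-1) ^ j * of_int (sign \<rho>)"
    using signof_permutation_insert[OF \<rho> _ j, of 0, where ?'a = rat] by simp
  finally have sgn: "of_int (sign ?\<sigma>) = (-1) ^ j * (of_int (sign \<rho>) :: rat)" .
  have "?\<sigma> 0 = 0" "?\<sigma> 1 = Suc j" "?\<sigma> (Suc (Suc x)) = Suc (insert_index j (\<rho> x))" for x
    by (simp_all add: permutation_insert_expand insert_index_def)
  then show ?thesis
    by (simp add: pf_term_def sgn prod.lessThan_Suc_shift o_def del: prod.lessThan_Suc)
qed

lemma pf_sum_expand:
  assumes anti: "\<And>i j. A j i = - A i j"
  shows "pf_sum (Suc n) A = 2 * of_nat (Suc n) * (\<Sum>j<Suc (2 * n). (-1) ^ j * A 0 (Suc j) *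
    pf_sum n (\<lambda>a b. A (Suc (insert_index j a)) (Suc (insert_index j b))))"
proof -
  let ?m = "Suc (2 * n)"
  have m: "{..<2 * Suc n} = {0..<Suc ?m}" by auto
  have "(\<Sum>\<sigma> | \<sigma> permutes {..<2 * Suc n} \<and> \<sigma> 0 = 0. pf_term (Suc n) A \<sigma>)
      = (\<Sum>\<tau> | \<tau> permutes {0..<?m}. pf_term (Suc n) A (permutation_insert 0 0 \<tau>))"
    unfolding m by (subst permutation_fix) (simp_all add: sum.reindex permutation_insert_inj_on)
  also have "\<dots> = (\<Sum>j<?m. \<Sum>\<tau> | \<tau> permutes {0..<?m} \<and> \<tau> 0 = j. pf_term (Suc n) A (permutation_insert 0 0 \<tau>))"
  proof -
    have "\<tau> 0 < ?m" if "\<tau> permutes {0..<?m}" for \<tau>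
      using permutes_in_image[OF that, of 0] by simp
    then have "(\<lambda>\<tau>. \<tau> 0) \<in> {\<tau>. \<tau> permutes {0..<?m}} \<rightarrow> {..<?m}"
      by auto
    then have "(\<lambda>\<tau>. \<tau> 0) ` {\<tau>. \<tau> permutes {0..<?m}} \<subseteq> {..<?m}"
      by auto
    from sum.group[OF _ _ this, of "\<lambda>\<tau>. pf_term (Suc n) A (permutation_insert 0 0 \<tau>)"]
    show ?thesis by (simp add: finite_permutations conj_commute)
  qed
  also have "\<dots> = (\<Sum>j<?m. \<Sum>\<rho> | \<rho> permutes {0..<2 * n}.
      pf_term (Suc n) A (permutation_insert 0 0 (permutation_insert 0 j \<rho>)))"
  proof (rule sum.cong[OF refl])
    fix j assume "j \<in> {..<?m}"
    then show "(\<Sum>\<tau> | \<tau> permutes {0..<?m} \<and> \<tau> 0 = j. pf_term (Suc n) A (permutation_insert 0 0 \<tau>))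
        = (\<Sum>\<rho> | \<rho> permutes {0..<2 * n}. pf_term (Suc n) A (permutation_insert 0 0 (permutation_insert 0 j \<rho>)))"
      by (subst permutation_fix) (simp_all add: sum.reindex permutation_insert_inj_on)
  qed
  also have "\<dots> = (\<Sum>j<?m. (-1) ^ j * A 0 (Suc j) *
      pf_sum n (\<lambda>a b. A (Suc (insert_index j a)) (Suc (insert_index j b))))"
    unfolding pf_sum_def sum_distrib_left lessThan_atLeast0
    by (intro sum.cong refl pf_term_insert) auto
  finally show ?thesis
    by (simp only: pf_sum_first[OF anti zero_less_Suc])
qed

text \<open>
  An antisymmetric matrix is given by the entries of a list and a function on pairs that is used in
  the order of the list only; deleting rows and columns of the matrix is deleting list elements.
\<close>

definition upper_entry :: "('a \<Rightarrow> 'a \<Rightarrow> rat) \<Rightarrow> 'a list \<Rightarrow> nat \<Rightarrow> nat \<Rightarrow> rat" where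
  "upper_entry e xs i j =
     (if i < j then e (xs ! i) (xs ! j) else if j < i then - e (xs ! j) (xs ! i) else 0)"

definition pf_list :: "('a \<Rightarrow> 'a \<Rightarrow> rat) \<Rightarrow> 'a list \<Rightarrow> rat" where
  "pf_list e xs = pf_sum (length xs div 2) (upper_entry e xs)
     / (2 ^ (length xs div 2) * fact (length xs div 2))"

definition omit :: "nat \<Rightarrow> 'a list \<Rightarrow> 'a list" where
  "omit j xs = take j xs @ drop (Suc j) xs"

lemma length_omit: "j < length xs \<Longrightarrow> length (omit j xs) = length xs - 1"
  by (simp add: omit_def)

lemma set_omit: "set (omit j xs) \<subseteq> set xs"
  by (auto simp: omit_def dest: in_set_takeD in_set_dropD)

lemma nth_omit:
  assumes "j < length xs" "a < length xs - 1"
  shows "omit j xs ! a = xs ! insert_index j a"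
  using assms by (auto simp: omit_def nth_append insert_index_def min_def)

lemma pf_sum_cong:
  assumes "\<And>i j. i < 2 * n \<Longrightarrow> j < 2 * n \<Longrightarrow> A i j = B i j"
  shows "pf_sum n A = pf_sum n B"
  unfolding pf_sum_def pf_term_def
proof (intro sum.cong refl arg_cong2[of _ _ _ _ "(*)"] prod.cong)
  fix \<sigma> i assume "\<sigma> \<in> {\<sigma>. \<sigma> permutes {..<2 * n}}" "i \<in> {..<n}"
  moreover from this have "\<sigma> x < 2 * n \<longleftrightarrow> x < 2 * n" for x
    using permutes_in_image[of \<sigma> "{..<2 * n}" x] by simp
  ultimately have "\<sigma> (2 * i) < 2 * n" "\<sigma> (2 * i + 1) < 2 * n"
    by simp_all
  then show "A (\<sigma> (2 * i)) (\<sigma> (2 * i + 1)) = B (\<sigma> (2 * i)) (\<sigma> (2 * i + 1))"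
    by (rule assms)
qed

lemma pf_list_Nil: "pf_list e [] = 1"
  by (simp add: pf_list_def pf_sum_def pf_term_def)

lemma pf_list_Cons:
  assumes "odd (length ys)"
  shows "pf_list e (x # ys) = (\<Sum>j<length ys. (-1) ^ j * e x (ys ! j) * pf_list e (omit j ys))"
proof -
  obtain n where n: "length ys = Suc (2 * n)"
    using assms by (auto elim: oddE)
  let ?A = "upper_entry e (x # ys)"
  have minor: "pf_sum n (\<lambda>a b. ?A (Suc (insert_index j a)) (Suc (insert_index j b)))
      = pf_sum n (upper_entry e (omit j ys))" if "j < length ys" for j
  proof (rule pf_sum_cong)
    fix a b assume "a < 2 * n" "b < 2 * n"
    moreover have "insert_index j a < insert_index j b \<longleftrightarrow> a < b"
        "insert_index j b < insert_index j a \<longleftrightarrow> b < a"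
      by (auto simp: insert_index_def)
    ultimately show "?A (Suc (insert_index j a)) (Suc (insert_index j b)) = upper_entry e (omit j ys) a b"
      using that n by (simp add: upper_entry_def nth_omit)
  qed
  have "pf_sum (Suc n) ?A = 2 * of_nat (Suc n) * (\<Sum>j<Suc (2 * n). (-1) ^ j * ?A 0 (Suc j) *
    pf_sum n (\<lambda>a b. ?A (Suc (insert_index j a)) (Suc (insert_index j b))))"
    by (rule pf_sum_expand) (auto simp: upper_entry_def)
  also have "\<dots> = 2 * of_nat (Suc n) * (\<Sum>j<length ys. (-1) ^ j * e x (ys ! j) *
      pf_sum n (upper_entry e (omit j ys)))"
    using minor by (intro arg_cong2[of _ _ _ _ "(*)"] sum.cong refl) (simp_all add: n upper_entry_def)
  finally have expand: "pf_sum (Suc n) ?A = 2 * of_nat (Suc n) *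
      (\<Sum>j<length ys. (-1) ^ j * e x (ys ! j) * pf_sum n (upper_entry e (omit j ys)))" .
  have half: "length (x # ys) div 2 = Suc n" using n by simp
  have "pf_list e (x # ys)
      = (\<Sum>j<length ys. (-1) ^ j * e x (ys ! j) * pf_sum n (upper_entry e (omit j ys))) / (2 ^ n * fact n)"
    unfolding pf_list_def half expand by (simp add: field_simps del: of_nat_Suc)
  also have "\<dots> = (\<Sum>j<length ys. (-1) ^ j * e x (ys ! j) * pf_list e (omit j ys))"
    unfolding sum_divide_distrib by (rule sum.cong) (simp_all add: pf_list_def length_omit n)
  finally show ?thesis .
qed

lemma Pfaffian_eq_pf_list:
  assumes "even (length xs)" "A \<in> carrier_mat (length xs) (length xs)"
    and "\<And>i j. i < length xs \<Longrightarrow> j < length xs \<Longrightarrow> A $$ (i, j) = upper_entry e xs i j"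
  shows "Pfaffian A = pf_list e xs"
proof -
  have dim: "dim_row A = length xs" using assms by simp
  have "pf_sum (length xs div 2) (\<lambda>i j. A $$ (i, j)) = pf_sum (length xs div 2) (upper_entry e xs)"
    using assms by (intro pf_sum_cong) auto
  then show ?thesis
    using assms(1) by (simp add: Pfaffian_def dim pf_list_def pf_sum_def pf_term_def Let_def)
qed

text \<open>
  Every term of the Pfaffian matches the indices in pairs. If a set \<open>R\<close> of indices can be matched
  with nonzero entries only to indices of a smaller set, every term has a zero factor.
\<close>

lemma pf_sum_eq_0:
  assumes anti: "\<And>i j. A j i = - A i j"
    and R: "finite C" "card C < card R" "R \<subseteq> {..<2 * n}"
    and nz: "\<And>i j. i \<in> R \<Longrightarrow> j < 2 * n \<Longrightarrow> A i j \<noteq> 0 \<Longrightarrow> j \<in> C"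
  shows "pf_sum n A = 0"
  unfolding pf_sum_def
proof (rule sum.neutral, rule ballI)
  fix \<sigma> assume "\<sigma> \<in> {\<sigma>. \<sigma> permutes {..<2 * n}}"
  then have \<sigma>: "\<sigma> permutes {..<2 * n}" by simp
  define flip where "flip t = (if even t then Suc t else t - 1)" for t :: nat
  define g where "g r = \<sigma> (flip (inv_into UNIV \<sigma> r))" for r
  have flip: "flip (flip t) = t" for t
    by (auto simp: flip_def elim: oddE)
  have "inj g"
  proof (rule injI)
    fix x y assume "g x = g y"
    then have "flip (inv_into UNIV \<sigma> x) = flip (inv_into UNIV \<sigma> y)"
      unfolding g_def using permutes_inj[OF \<sigma>] by (simp add: inj_eq)
    then have "inv_into UNIV \<sigma> x = inv_into UNIV \<sigma> y" using flip by metis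
    then show "x = y" using permutes_inverses(1)[OF \<sigma>] by metis
  qed
  then have "card (g ` R) = card R"
    by (intro card_image) (auto simp: inj_on_def inj_def)
  then have "\<not> g ` R \<subseteq> C"
    using R card_mono[of C "g ` R"] by linarith
  then obtain r where r: "r \<in> R" "g r \<notin> C" by blast
  define t where "t = inv_into UNIV \<sigma> r"
  have \<sigma>t: "\<sigma> t = r" unfolding t_def by (rule permutes_inverses(1)[OF \<sigma>])
  have t: "t < 2 * n"
    using permutes_in_image[OF permutes_inv[OF \<sigma>], of r] r R by (auto simp: t_def)
  then have ft: "flip t < 2 * n" by (auto simp: flip_def elim: evenE) 
  then have "\<sigma> (flip t) < 2 * n"
    using permutes_in_image[OF \<sigma>, of "flip t"] by simp
  then have "A r (g r) = 0"
    using nz[OF r(1)] r(2) by (auto simp: g_def t_def)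
  then have zero: "A (\<sigma> t) (\<sigma> (flip t)) = 0" "A (\<sigma> (flip t)) (\<sigma> t) = 0"
    using anti[of "\<sigma> (flip t)" "\<sigma> t"] \<sigma>t by (auto simp: g_def t_def[symmetric])
  have "A (\<sigma> (2 * (t div 2))) (\<sigma> (2 * (t div 2) + 1)) = 0"
  proof (cases "even t")
    case True
    then show ?thesis using zero by (simp add: flip_def)
  next
    case False
    then show ?thesis using zero by (auto simp: flip_def elim!: oddE)
  qed
  then have "(\<Prod>i<n. A (\<sigma> (2 * i)) (\<sigma> (2 * i + 1))) = 0"
    using t by (intro prod_zero) (auto intro!: bexI[of _ "t div 2"])
  then show "pf_term n A \<sigma> = 0" by (simp add: pf_term_def)
qed


section \<open>Wick's theorem\<close>

text \<open>
  The linear combinations of the $Q_m$, as operators. Their anticommutator with each $Q_m$ is a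
  scalar.
\<close>

inductive fermion :: "(gamma \<Rightarrow> gamma) \<Rightarrow> bool" where
  vertex: "fermion (Q_op m)"
| scale: "fermion \<phi> \<Longrightarrow> fermion (\<lambda>f. scalar c * \<phi> f)"
| add: "fermion \<phi> \<Longrightarrow> fermion \<psi> \<Longrightarrow> fermion (\<lambda>f. \<phi> f + \<psi> f)"

lemma fermion_sum:
  fixes n :: nat
  assumes "\<And>i. i \<le> n \<Longrightarrow> fermion (\<phi> i)"
  shows "fermion (\<lambda>f. \<Sum>i\<le>n. \<phi> i f)"
  using assms by (induction n) (auto intro: fermion.add)

lemma fermion_plus: "fermion \<phi> \<Longrightarrow> \<phi> (f + g) = \<phi> f + \<phi> g"
  by (induction rule: fermion.induct) (auto simp: Q_op_add distrib_left)

lemma fermion_scalar: "fermion \<phi> \<Longrightarrow> \<phi> (scalar c * f) = scalar c * \<phi> f"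
  by (induction rule: fermion.induct) (auto simp: Q_op_scalar distrib_left mult.left_commute)

lemma fermion_anticommute:
  assumes "fermion \<phi>"
  shows "\<exists>c. \<forall>f. \<phi> (Q_op m f) + Q_op m (\<phi> f) = scalar c * f"
  using assms
proof (induction rule: fermion.induct)
  case (vertex n)
  show ?case
    by (rule exI, rule allI, rule Q_op_anticommute)
next
  case (scale \<phi> d)
  then obtain c where "\<forall>f. \<phi> (Q_op m f) + Q_op m (\<phi> f) = scalar c * f" by blast
  then have "\<forall>f. scalar d * \<phi> (Q_op m f) + Q_op m (scalar d * \<phi> f) = scalar (d * c) * f"
    by (simp add: Q_op_scalar distrib_left[symmetric] scalar_mult mult.assoc)
  then show ?case ..
next
  case (add \<phi> \<psi>)
  then obtain c d where cd: "\<And>f. \<phi> (Q_op m f) + Q_op m (\<phi> f) = scalar c * f"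
    "\<And>f. \<psi> (Q_op m f) + Q_op m (\<psi> f) = scalar d * f" by blast
  have "\<phi> (Q_op m f) + \<psi> (Q_op m f) + Q_op m (\<phi> f + \<psi> f) = scalar (c + d) * f" for f
  proof -
    have "\<phi> (Q_op m f) + \<psi> (Q_op m f) + Q_op m (\<phi> f + \<psi> f)
        = (\<phi> (Q_op m f) + Q_op m (\<phi> f)) + (\<psi> (Q_op m f) + Q_op m (\<psi> f))"
      by (simp only: Q_op_add ac_simps)
    also have "\<dots> = scalar (c + d) * f"
      by (simp only: cd scalar_add distrib_right)
    finally show ?thesis .
  qed
  then show ?case by blast
qed

text \<open>The head of the list is applied first, so it stands next to the vacuum.\<close>

definition apply_ops :: "(gamma \<Rightarrow> gamma) list \<Rightarrow> gamma \<Rightarrow> gamma" where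
  "apply_ops = fold (\<lambda>\<phi>. \<phi>)"

definition vac :: "(gamma \<Rightarrow> gamma) list \<Rightarrow> rat" where
  "vac \<phi>s = eps (apply_ops \<phi>s 1)"

lemma apply_ops_Nil [simp]: "apply_ops [] f = f"
  and apply_ops_Cons [simp]: "apply_ops (\<phi> # \<phi>s) f = apply_ops \<phi>s (\<phi> f)"
  by (simp_all add: apply_ops_def)

lemma apply_ops_add:
  "\<forall>\<phi>\<in>set \<phi>s. fermion \<phi> \<Longrightarrow> apply_ops \<phi>s (f + g) = apply_ops \<phi>s f + apply_ops \<phi>s g"
  by (induction \<phi>s arbitrary: f g) (auto simp: fermion_plus)

lemma apply_ops_scalar:
  "\<forall>\<phi>\<in>set \<phi>s. fermion \<phi> \<Longrightarrow> apply_ops \<phi>s (scalar c * f) = scalar c * apply_ops \<phi>s f"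
  by (induction \<phi>s arbitrary: f) (auto simp: fermion_scalar)

lemma omit_0 [simp]: "omit 0 (x # xs) = xs"
  and omit_Suc [simp]: "omit (Suc j) (x # xs) = x # omit j xs"
  by (simp_all add: omit_def)

lemma apply_ops_move:
  assumes "\<forall>\<phi>\<in>set \<phi>s. fermion \<phi>"
    and "\<And>\<phi> f. \<phi> \<in> set \<phi>s \<Longrightarrow> \<phi> (Q_op m f) + Q_op m (\<phi> f) = scalar (c \<phi>) * f"
  shows "apply_ops \<phi>s (Q_op m f)
    = (\<Sum>j<length \<phi>s. scalar ((-1) ^ j * c (\<phi>s ! j)) * apply_ops (omit j \<phi>s) f)
      + scalar ((-1) ^ length \<phi>s) * Q_op m (apply_ops \<phi>s f)"
  using assms
proof (induction \<phi>s arbitrary: f)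
  case (Cons \<phi> \<phi>s)
  let ?rest = "\<lambda>f. \<Sum>j<length \<phi>s. scalar ((-1) ^ j * c (\<phi>s ! j)) * apply_ops (omit j \<phi>s) f"
  have eq: "\<phi> (Q_op m f) = scalar (c \<phi>) * f + scalar (-1) * Q_op m (\<phi> f)"
    using Cons.prems(2)[of \<phi> f] by (simp add: scalar_uminus eq_diff_eq)
  have "apply_ops (\<phi> # \<phi>s) (Q_op m f)
      = scalar (c \<phi>) * apply_ops \<phi>s f + scalar (-1) * apply_ops \<phi>s (Q_op m (\<phi> f))"
    using Cons.prems by (simp add: eq apply_ops_add apply_ops_scalar)
  also have "apply_ops \<phi>s (Q_op m (\<phi> f))
      = ?rest (\<phi> f) + scalar ((-1) ^ length \<phi>s) * Q_op m (apply_ops \<phi>s (\<phi> f))"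
    using Cons.prems by (intro Cons.IH) auto
  also have "scalar (c \<phi>) * apply_ops \<phi>s f
      + scalar (-1) * (?rest (\<phi> f) + scalar ((-1) ^ length \<phi>s) * Q_op m (apply_ops \<phi>s (\<phi> f)))
    = scalar (c \<phi>) * apply_ops \<phi>s f + (\<Sum>j<length \<phi>s. scalar (-1) *
        (scalar ((-1) ^ j * c (\<phi>s ! j)) * apply_ops (omit j \<phi>s) (\<phi> f)))
      + scalar (-1) * (scalar ((-1) ^ length \<phi>s) * Q_op m (apply_ops \<phi>s (\<phi> f)))"
    by (simp only: distrib_left sum_distrib_left add.assoc)
  also have "\<dots> = (\<Sum>j<length (\<phi> # \<phi>s). scalar ((-1) ^ j * c ((\<phi> # \<phi>s) ! j)) * apply_ops (omit j (\<phi> # \<phi>s)) f)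
      + scalar ((-1) ^ length (\<phi> # \<phi>s)) * Q_op m (apply_ops (\<phi> # \<phi>s) f)"
    by (simp add: sum.lessThan_Suc_shift scalar_uminus del: sum.lessThan_Suc)
  finally show ?case .
qed simp

text \<open>
  By linearity the head may be taken to be some $Q_m$. For $m < 0$ it kills the vacuum. Otherwise
  it is moved through the word to the other end, leaving the anticommutators behind; there it
  vanishes under \<open>eps\<close> for $m > 0$. The operator $Q_0$ disappears without a trace at both ends, but
  after passing an odd number of operators it comes with a minus sign. So twice the expectation is
  the sum over the anticommutators, and these are twice the two-point functions.
\<close>

theorem wick:
  assumes "fermion \<phi>" "\<forall>\<psi>\<in>set \<phi>s. fermion \<psi>" "odd (length \<phi>s)"
  shows "vac (\<phi> # \<phi>s) = (\<Sum>j<length \<phi>s. (-1) ^ j * vac [\<phi>, \<phi>s ! j] * vac (omit j \<phi>s))"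
  using assms(1)
proof (induction rule: fermion.induct)
  case (vertex m)
  obtain c where c: "\<And>\<psi> f. \<psi> \<in> set \<phi>s \<Longrightarrow> \<psi> (Q_op m f) + Q_op m (\<psi> f) = scalar (c \<psi>) * f"
  proof -
    have "\<forall>\<psi>\<in>set \<phi>s. \<exists>c. \<forall>f. \<psi> (Q_op m f) + Q_op m (\<psi> f) = scalar c * f"
      using fermion_anticommute assms(2) by blast
    from bchoice[OF this] show thesis using that by blast
  qed
  have pair: "eps (\<psi> (Q_op m 1)) = c \<psi> - eps (Q_op m (\<psi> 1))" if "\<psi> \<in> set \<phi>s" for \<psi>
    using c[OF that, of 1] eps_scalar[of "c \<psi>" 1] by (metis add_diff_cancel_right' eps_1 eps_diff mult_1_right)
  have move: "vac (Q_op m # \<phi>s) = (\<Sum>j<length \<phi>s. (-1) ^ j * c (\<phi>s ! j) * vac (omit j \<phi>s))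
      - eps (Q_op m (apply_ops \<phi>s 1))"
    using apply_ops_move[OF assms(2) c, of 1] assms(3)
    by (simp add: vac_def eps_add eps_diff eps_sum eps_scalar scalar_uminus eps_minus)
  show ?case
  proof (cases m "0 :: int" rule: linorder_cases)
    case less
    have "apply_ops \<psi>s 0 = 0" if "\<forall>\<psi>\<in>set \<psi>s. fermion \<psi>" for \<psi>s
      using apply_ops_scalar[OF that, of 0 0] by simp
    moreover have "(\<phi>s ! j) 0 = 0" if "j < length \<phi>s" for j
      using fermion_scalar[of "\<phi>s ! j" 0 0] assms(2) that by simp
    ultimately show ?thesis
      using assms(2) less by (simp add: vac_def Q_op_neg_1)
  next
    case equal
    have "c (\<phi>s ! j) = 2 * vac [Q_op m, \<phi>s ! j]" if "j < length \<phi>s" for j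
      using pair[of "\<phi>s ! j"] that equal by (simp add: vac_def Q_op_0_1 eps_Q_op_0)
    then have "(\<Sum>j<length \<phi>s. (-1) ^ j * c (\<phi>s ! j) * vac (omit j \<phi>s))
        = 2 * (\<Sum>j<length \<phi>s. (-1) ^ j * vac [Q_op m, \<phi>s ! j] * vac (omit j \<phi>s))"
      by (simp add: sum_distrib_left mult_ac)
    moreover have "eps (Q_op m (apply_ops \<phi>s 1)) = vac (Q_op m # \<phi>s)"
      using equal by (simp add: vac_def Q_op_0_1 eps_Q_op_0)
    ultimately show ?thesis using move by simp
  next
    case greater
    have "c (\<phi>s ! j) = vac [Q_op m, \<phi>s ! j]" if "j < length \<phi>s" for j
      using pair[of "\<phi>s ! j"] that greater by (simp add: vac_def eps_Q_op_pos)
    then show ?thesis using move greater by (simp add: eps_Q_op_pos)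
  qed
next
  case (scale \<phi> d)
  have "vac ((\<lambda>f. scalar d * \<phi> f) # \<psi>s) = d * vac (\<phi> # \<psi>s)" if "\<forall>\<psi>\<in>set \<psi>s. fermion \<psi>" for \<psi>s
    using that by (simp add: vac_def apply_ops_scalar eps_scalar)
  then show ?case
    using scale assms(2) by (simp add: sum_distrib_left mult_ac)
next
  case (add \<phi> \<psi>)
  have "vac ((\<lambda>f. \<phi> f + \<psi> f) # \<psi>s) = vac (\<phi> # \<psi>s) + vac (\<psi> # \<psi>s)" if "\<forall>\<psi>\<in>set \<psi>s. fermion \<psi>" for \<psi>s
    using that by (simp add: vac_def apply_ops_add eps_add)
  then show ?case
    using add assms(2) by (simp add: sum.distrib algebra_simps)
qed

corollary vac_eq_pf_list:
  assumes "\<forall>\<phi>\<in>set \<phi>s. fermion \<phi>" "even (length \<phi>s)"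
  shows "vac \<phi>s = pf_list (\<lambda>\<phi> \<psi>. vac [\<phi>, \<psi>]) \<phi>s"
  using assms
proof (induction "length \<phi>s" arbitrary: \<phi>s rule: less_induct)
  case less
  show ?case
  proof (cases \<phi>s)
    case Nil
    then show ?thesis by (simp add: vac_def pf_list_Nil)
  next
    case (Cons \<phi> \<psi>s)
    have IH: "vac (omit j \<psi>s) = pf_list (\<lambda>\<phi> \<psi>. vac [\<phi>, \<psi>]) (omit j \<psi>s)" if "j < length \<psi>s" for j
    proof (rule less.hyps)
      show "length (omit j \<psi>s) < length \<phi>s" "even (length (omit j \<psi>s))"
        using that less.prems Cons by (simp_all add: length_omit)
      show "\<forall>\<phi>\<in>set (omit j \<psi>s). fermion \<phi>"
        using set_omit[of j \<psi>s] less.prems(1) Cons by auto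
    qed
    have prems: "fermion \<phi>" "\<forall>\<psi>\<in>set \<psi>s. fermion \<psi>" "odd (length \<psi>s)"
      using less.prems Cons by simp_all
    show ?thesis
      unfolding Cons wick[OF prems] pf_list_Cons[OF prems(3)]
      by (rule sum.cong) (simp_all add: IH)
  qed
qed


section \<open>Moving the multiplication operator to the vacuum\<close>

text \<open>
  Homogeneous polynomials, where $p_m$ has degree $m$.
\<close>

definition homog :: "int \<Rightarrow> gamma \<Rightarrow> bool" where
  "homog d f \<longleftrightarrow> (\<forall>\<alpha>\<in>Poly_Mapping.keys f. int (weight \<alpha>) = d)"

lemma weight_0 [simp]: "weight 0 = 0"
  by (simp add: weight_def)

lemma homog_0 [simp]: "homog d 0"
  by (simp add: homog_def)

lemma homog_1: "homog 0 1"
  by (simp add: homog_def)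

lemma homog_add: "homog d f \<Longrightarrow> homog d g \<Longrightarrow> homog d (f + g)"
  unfolding homog_def using Poly_Mapping.keys_add[of f g] by blast

lemma homog_sum: "(\<And>x. x \<in> A \<Longrightarrow> homog d (h x)) \<Longrightarrow> homog d (sum h A)"
  by (induction A rule: infinite_finite_induct) (auto intro: homog_add)

lemma homog_mult:
  assumes "homog d f" "homog d' g"
  shows "homog (d + d') (f * g)"
  unfolding homog_def
proof
  fix \<gamma> assume "\<gamma> \<in> Poly_Mapping.keys (f * g)"
  then obtain \<alpha> \<beta> where "\<gamma> = \<alpha> + \<beta>" "\<alpha> \<in> Poly_Mapping.keys f" "\<beta> \<in> Poly_Mapping.keys g"
    using Poly_Mapping.keys_mult[of f g] by blast
  then show "int (weight \<gamma>) = d + d'"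
    using assms by (simp add: homog_def weight_add)
qed

lemma homog_scalar: "homog d f \<Longrightarrow> homog d (scalar c * f)"
  using homog_mult[of 0 "scalar c" d f] by (simp add: homog_def scalar_def)

lemma homog_pvar: "odd m \<Longrightarrow> homog (int m) (pvar m)"
  using weight_single[of "m div 2"] by (auto simp: homog_def pvar_def)

lemma homog_T_mult:
  assumes "odd s"
  shows "homog (int (s * k)) (T_mult s k)"
proof (induction k rule: less_induct)
  case (less k)
  show ?case
  proof (cases "k = 0")
    case True
    then show ?thesis by (simp add: homog_1)
  next
    case False
    have "homog (int (s * k)) (\<Sum>m | odd m \<and> m \<le> k. scalar 2 * (pvar (s * m) * T_mult s (k - m)))"
    proof (intro homog_sum homog_scalar)
      fix m assume m: "m \<in> {m. odd m \<and> m \<le> k}"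
      then have "m > 0" by (auto intro: gr0I)
      then have "homog (int (s * m) + int (s * (k - m))) (pvar (s * m) * T_mult s (k - m))"
        using m False assms by (intro homog_mult homog_pvar less) auto
      moreover have "int (s * m) + int (s * (k - m)) = int (s * k)"
        using m by (simp add: of_nat_diff algebra_simps)
      ultimately show "homog (int (s * k)) (pvar (s * m) * T_mult s (k - m))" by metis
    qed
    then have "homog (int (s * k)) (scalar (of_nat k) * T_mult s k)"
      by (simp add: T_mult_recurrence mult.assoc)
    then have "homog (int (s * k)) (scalar (1 / of_nat k) * (scalar (of_nat k) * T_mult s k))"
      by (rule homog_scalar)
    moreover have "scalar (1 / of_nat k) * (scalar (of_nat k) * T_mult s k) = T_mult s k"
      by (rule scalar_inverse_cancel(1)) (use False in simp)
    ultimately show ?thesis by (simp only:)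
  qed
qed

lemma homog_Tz:
  assumes "odd s"
  shows "homog (int s * k) (Tz s k)"
  using homog_T_mult[OF assms, of "nat k"] by (auto simp: Tz_def)

lemma homog_Dz:
  assumes "homog d f"
  shows "homog (d - j) (Dz j f)"
proof (cases "j \<ge> 0")
  case True
  then obtain i where j: "j = int i" by (metis nonneg_int_cases)
  have "homog (d - int i) (exp_diff_coeff i f)"
    unfolding exp_diff_coeff_def
  proof (intro homog_sum homog_scalar)
    fix k
    show "homog (d - int i) (fps_nth ((diff_series_op ^^ k) (fps_const f)) i)"
      unfolding homog_def using keys_diff_series_op_power[of _ k f i] assms
      by (fastforce simp: homog_def)
  qed
  then show ?thesis by (simp add: j Dz_def)
qed simp

lemma homog_Q_op:
  assumes "homog d f"
  shows "homog (d + m) (Q_op m f)"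
proof -
  have "homog (d + m) (Tz 1 (m + j) * Dz j f)" for j
    using homog_mult[OF homog_Tz[of 1 "m + j"] homog_Dz[OF assms, of j]]
    by (simp add: algebra_simps)
  then show ?thesis
    by (subst Q_op_eq_sum[of "{j. Dz j f \<noteq> 0}"]) (auto simp: finite_Dz_support intro!: homog_sum)
qed

lemma eps_homog: "homog d f \<Longrightarrow> d \<noteq> 0 \<Longrightarrow> eps f = 0"
  by (metis eps_def homog_def in_keys_iff of_nat_0 weight_0)

lemma homog_Q_fun: "homog (int (sum_list lam)) (Q_fun lam)"
proof (induction lam)
  case (Cons m lam)
  then show ?case using homog_Q_op[OF Cons.IH, of "int m"] by (simp add: add.commute)
qed (simp add: homog_1)

definition shifted :: "nat \<Rightarrow> nat \<Rightarrow> nat \<Rightarrow> gamma \<Rightarrow> gamma" where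
  "shifted s l i g = scalar (parity_sign (int l) * acoef i) * Q_op (int (s * i) - int l) g"

text \<open>
  With $T^{(s)} = \sum_k T^{(s)}_k$, the operator $(T^{(s)})^{-1} Q_l^* T^{(s)}$ is the series
  $\sum_i f_{si} Q^*_{l - si}$. It is cut off at \<open>J\<close>, so as to be an operator on polynomials.
\<close>

definition Psi :: "nat \<Rightarrow> nat \<Rightarrow> nat \<Rightarrow> gamma \<Rightarrow> gamma" where
  "Psi s J l g = (\<Sum>i\<le>J. shifted s l i g)"

lemma homog_shifted: "homog d g \<Longrightarrow> homog (d + int (s * i) - int l) (shifted s l i g)"
  unfolding shifted_def using homog_scalar homog_Q_op[of d g "int (s * i) - int l"]
  by (simp add: add_diff_eq)

lemma fermion_shifted: "fermion (shifted s l i)"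
  using fermion.scale[OF fermion.vertex] by (simp add: shifted_def[abs_def])

lemma fermion_Psi: "fermion (Psi s J l)"
  using fermion_sum[where n = J and \<phi> = "shifted s l", OF fermion_shifted] by (simp add: Psi_def[abs_def])

lemma Q_adj_T_mult:
  assumes "odd s"
  shows "Q_adj l (T_mult s k * g) = (\<Sum>i\<le>k. T_mult s (k - i) * shifted s l i g)"
  unfolding Q_adj_def Q_op_T_mult[OF assms] sum_distrib_left
  by (rule sum.cong)
    (auto simp: shifted_def scalar_mult Tz_def nat_diff_distrib' mult_ac)

lemma fold_Q_adj_sum: "fold Q_adj lam (sum h A) = (\<Sum>x\<in>A. fold Q_adj lam (h x))"
  by (induction A rule: infinite_finite_induct) (auto simp: fold_Q_adj_add)

lemma fold_Psi_conv: "fold (Psi s J) lam = apply_ops (map (Psi s J) lam)"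
  by (simp add: apply_ops_def fold_map o_def)

lemma fold_Psi_sum: "fold (Psi s J) lam (sum h A) = (\<Sum>x\<in>A. fold (Psi s J) lam (h x))"
proof -
  have *: "\<forall>\<phi>\<in>set (map (Psi s J) lam). fermion \<phi>" by (auto simp: fermion_Psi)
  have "apply_ops (map (Psi s J) lam) 0 = 0"
    using apply_ops_scalar[OF *, of 0 0] by simp
  then show ?thesis
    unfolding fold_Psi_conv
    by (induction A rule: infinite_finite_induct) (auto simp: apply_ops_add[OF *])
qed

lemma eps_fold_Psi_eq_0:
  assumes "homog d g" "d > int (sum_list lam)"
  shows "eps (fold (Psi s J) lam g) = 0"
  using assms
proof (induction lam arbitrary: g d)
  case Nil
  then show ?case by (simp add: eps_homog)
next
  case (Cons l lam)
  have "eps (fold (Psi s J) lam (shifted s l i g)) = 0" for i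
  proof (rule Cons.IH)
    show "homog (d + int (s * i) - int l) (shifted s l i g)"
      using Cons.prems(1) by (rule homog_shifted)
    show "d + int (s * i) - int l > int (sum_list lam)"
    proof -
      have "0 \<le> int (s * i)" by simp
      then show ?thesis using Cons.prems(2) by (simp del: of_nat_mult)
    qed
  qed
  then show ?case by (simp add: Psi_def[of s J l] fold_Psi_sum eps_sum)
qed

lemma eps_fold_Q_adj_T_mult_eq_0:
  assumes "odd s" "homog d g" "int (sum_list lam) \<noteq> d + int (s * k)"
  shows "eps (fold Q_adj lam (T_mult s k * g)) = 0"
  using assms(2,3)
proof (induction lam arbitrary: g d k)
  case Nil
  then show ?case
    using eps_homog[OF homog_mult[OF homog_T_mult[OF assms(1)] Nil.prems(1)]] by simp
next
  case (Cons l lam)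
  have "eps (fold Q_adj lam (T_mult s (k - i) * shifted s l i g)) = 0" if "i \<le> k" for i
  proof (rule Cons.IH)
    show "homog (d + int (s * i) - int l) (shifted s l i g)"
      using Cons.prems(1) by (rule homog_shifted)
    show "int (sum_list lam) \<noteq> d + int (s * i) - int l + int (s * (k - i))"
      using Cons.prems(2) that by (simp add: of_nat_diff algebra_simps)
  qed
  then show ?case by (simp add: Q_adj_T_mult[OF assms(1)] fold_Q_adj_sum eps_sum)
qed

text \<open>
  Moving $T^{(s)}_k$ to the left leaves $T^{(s)}_{k-r}$ where \<open>r\<close> is the sum of the chosen shifts, so
  \<open>eps\<close> keeps the terms with $r = k$. The product of the \<open>Psi\<close> has all choices of shifts, but those
  with $r \neq k$ have a nonzero degree.
\<close>

lemma eps_fold_Q_adj_T_mult: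
  assumes "odd s" "homog d g" "int (sum_list lam) = d + int (s * k)" "k \<le> J"
  shows "eps (fold Q_adj lam (T_mult s k * g)) = eps (fold (Psi s J) lam g)"
  using assms(2-)
proof (induction lam arbitrary: g d k)
  case Nil
  show ?case
  proof (cases "k = 0")
    case False
    then have "s * k > 0" using assms(1) by (auto intro: gr0I)
    then have "int (s * k) > 0" by (simp only: of_nat_0_less_iff)
    then have "d \<noteq> 0" using Nil.prems(2) unfolding sum_list.Nil by linarith
    then show ?thesis
      using False Nil.prems(1) by (simp add: eps_mult eps_T_mult eps_homog)
  qed simp
next
  case (Cons l lam)
  have s: "s > 0" using assms(1) by (auto intro: gr0I)
  have "eps (fold Q_adj (l # lam) (T_mult s k * g))
      = (\<Sum>i\<le>k. eps (fold Q_adj lam (T_mult s (k - i) * shifted s l i g)))"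
    by (simp add: Q_adj_T_mult[OF assms(1)] fold_Q_adj_sum eps_sum)
  also have "\<dots> = (\<Sum>i\<le>k. eps (fold (Psi s J) lam (shifted s l i g)))"
  proof (rule sum.cong[OF refl])
    fix i assume i: "i \<in> {..k}"
    show "eps (fold Q_adj lam (T_mult s (k - i) * shifted s l i g)) = eps (fold (Psi s J) lam (shifted s l i g))"
    proof (rule Cons.IH)
      show "homog (d + int (s * i) - int l) (shifted s l i g)"
        using Cons.prems(1) by (rule homog_shifted)
      show "int (sum_list lam) = d + int (s * i) - int l + int (s * (k - i))"
        using Cons.prems(2) i by (simp add: of_nat_diff algebra_simps)
      show "k - i \<le> J" using Cons.prems(3) by simp
    qed
  qed
  \<comment> \<open>A shift beyond \<open>k\<close> makes the degree positive, and the remaining shifts only increase it.\<close>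
  also have "\<dots> = (\<Sum>i\<le>J. eps (fold (Psi s J) lam (shifted s l i g)))"
  proof (rule sum.mono_neutral_left)
    show "\<forall>i\<in>{..J} - {..k}. eps (fold (Psi s J) lam (shifted s l i g)) = 0"
    proof
      fix i assume "i \<in> {..J} - {..k}"
      then have "s * k < s * i" using s by simp
      then have "int (s * k) < int (s * i)" by (simp only: of_nat_less_iff)
      then have "d + int (s * i) - int l > int (sum_list lam)"
        using Cons.prems(2) unfolding sum_list.Cons of_nat_add by linarith
      with homog_shifted[OF Cons.prems(1)]
      show "eps (fold (Psi s J) lam (shifted s l i g)) = 0"
        by (rule eps_fold_Psi_eq_0)
    qed
  qed (use Cons.prems(3) in auto)
  also have "\<dots> = eps (fold (Psi s J) (l # lam) g)"
    by (simp add: Psi_def[of s J l] fold_Psi_sum eps_sum)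
  finally show ?case .
qed


section \<open>The two-point functions\<close>

text \<open>
  The factor of a part of $\mu$, normalized to make the two-point functions with the \<open>Psi\<close> equal to
  the entries of \<open>X_mat\<close>. The part 0 that may be appended to $\mu$ needs no halving, as $Q_0^2 = 1$
  whereas $Q_m^* Q_m + Q_m Q_m^* = 2$ for $m > 0$.
\<close>

definition half_Q :: "nat \<Rightarrow> gamma \<Rightarrow> gamma" where
  "half_Q m g = scalar (if m = 0 then 1 else 1/2) * Q_op (int m) g"

lemma fermion_half_Q: "fermion (half_Q m)"
  using fermion.scale[OF fermion.vertex] by (simp add: half_Q_def[abs_def])

lemma eps_Q_op_Q_op_1:
  "eps (Q_op x (Q_op y 1))
    = (if x + y \<noteq> 0 \<or> y < 0 then 0 else if y = 0 then 1 else 2 * parity_sign y)"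
proof (cases x "0 :: int" rule: linorder_cases)
  case less
  have "eps (Q_op x (Q_op y 1)) + eps (Q_op y (Q_op x 1))
      = (if x + y = 0 then 2 * parity_sign x else 0)"
    using arg_cong[OF Q_op_anticommute[of x y 1], of eps] by (simp only: eps_add eps_scalar) simp
  then show ?thesis
    using less by (auto simp: Q_op_neg_1 parity_sign_minus add_eq_0_iff2)
next
  case equal
  then show ?thesis by (auto simp: eps_Q_op_0 Q_op_1 eps_Tz)
next
  case greater
  then show ?thesis by (auto simp: eps_Q_op_pos)
qed

lemma vac_half_Q_half_Q: "m < m' \<Longrightarrow> vac [half_Q m, half_Q m'] = 0"
  by (simp add: vac_def half_Q_def Q_op_scalar eps_scalar eps_Q_op_pos)

text \<open>
  The coefficients in \<open>Psi\<close> are the numbers $f_{si}$ up to sign, and $f$ vanishes off the multiples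
  of \<open>s\<close>, so sums over shifts are sums over intervals of integers.
\<close>

lemma sum_multiples:
  assumes "s > 0"
  shows "(\<Sum>i\<le>J. parity_sign (int i) * acoef i * G (int (s * i)))
    = (\<Sum>A\<in>{0..int (s * J)}. f_one s A * G A)"
proof -
  have f: "parity_sign (int i) * acoef i = f_one s (int (s * i))" for i
    using assms by (auto simp: acoef_def f_one_def parity_sign_def)
  have inj: "inj_on (\<lambda>i. int (s * i)) {..J}"
    using assms by (auto simp: inj_on_def)
  have "(\<Sum>A\<in>{0..int (s * J)}. f_one s A * G A) = (\<Sum>A\<in>(\<lambda>i. int (s * i)) ` {..J}. f_one s A * G A)"
  proof (rule sum.mono_neutral_right)
    show "\<forall>A\<in>{0..int (s * J)} - (\<lambda>i. int (s * i)) ` {..J}. f_one s A * G A = 0"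
    proof
      fix A assume A: "A \<in> {0..int (s * J)} - (\<lambda>i. int (s * i)) ` {..J}"
      have "\<not> int s dvd A"
      proof
        assume "int s dvd A"
        then obtain q where q: "A = int s * q" by (elim dvdE)
        then have "q \<ge> 0" "q \<le> int J"
          using A assms by (auto simp: zero_le_mult_iff)
        then have "A = int (s * nat q)" "nat q \<le> J" using q by auto
        then show False using A by blast
      qed
      then show "f_one s A * G A = 0" by (auto simp: f_one_def)
    qed
  qed (use assms in auto)
  also have "\<dots> = (\<Sum>i\<le>J. parity_sign (int i) * acoef i * G (int (s * i)))"
    by (simp only: sum.reindex[OF inj] o_def f)
  finally show ?thesis ..
qed

lemma vac_half_Q_Psi:
  assumes "odd s" "l \<le> J"
  shows "vac [half_Q m, Psi s J l] = f_one s (int l - int m)"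
proof -
  have s: "s > 0" using assms(1) by (auto intro: gr0I)
  have "vac [half_Q m, Psi s J l] = (\<Sum>i\<le>J. parity_sign (int l) * acoef i *
      ((if m = 0 then 1 else 1/2) * eps (Q_op (int (s * i) - int l) (Q_op (int m) 1))))"
    by (simp only: vac_def apply_ops_Cons apply_ops_Nil half_Q_def Psi_def shifted_def Q_op_scalar
        eps_sum eps_scalar)
  also have "\<dots> = (\<Sum>i\<le>J. parity_sign (int i) * acoef i * (if int (s * i) = int l - int m then 1 else 0))"
  proof (rule sum.cong[OF refl])
    fix i
    have "parity_sign (int l) * parity_sign (int m) = parity_sign (int i)" if "int (s * i) = int l - int m"
    proof -
      have "parity_sign (int l) * parity_sign (int m) = parity_sign (int l - int m)"
        by (simp add: parity_sign_diff)
      also have "\<dots> = parity_sign (int i)"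
        unfolding that[symmetric] using assms(1) by (simp add: parity_sign_def)
      finally show ?thesis .
    qed
    then show "parity_sign (int l) * acoef i *
        ((if m = 0 then 1 else 1/2) * eps (Q_op (int (s * i) - int l) (Q_op (int m) 1)))
      = parity_sign (int i) * acoef i * (if int (s * i) = int l - int m then 1 else 0)"
      unfolding eps_Q_op_Q_op_1 by (auto simp: mult_ac)
  qed
  also have "\<dots> = (\<Sum>A\<in>{0..int (s * J)}. f_one s A * (if A = int l - int m then 1 else 0))"
    by (rule sum_multiples[OF s])
  also have "\<dots> = (\<Sum>A\<in>{0..int (s * J)}. if A = int l - int m then f_one s A else 0)"
    by (rule sum.cong) auto
  also have "\<dots> = (if int l - int m \<in> {0..int (s * J)} then f_one s (int l - int m) else 0)"
    by (rule sum.delta) simp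
  also have "\<dots> = f_one s (int l - int m)"
  proof -
    have "J \<le> s * J" using s by simp
    then have "int l - int m \<le> int (s * J)" using assms(2) by linarith
    then show ?thesis by (auto simp: f_one_def)
  qed
  finally show ?thesis .
qed

text \<open>
  Only the products $Q_{-t} Q_t$ with $t \geq 0$ contribute, and \<open>t\<close> is the summation index of
  \<open>f_two\<close>. The bound on \<open>J\<close> makes the cutoff harmless.
\<close>

lemma vac_Psi_Psi:
  assumes "odd s" "l + l' \<le> J" "l' > 0"
  shows "vac [Psi s J l, Psi s J l'] = f_two s l l'"
proof -
  have s: "s > 0" using assms(1) by (auto intro: gr0I)
  define K where "K = int (s * J)"
  have "J \<le> s * J" using s by simp
  then have K: "int l + int l' \<le> K" unfolding K_def using assms(2) by linarith
  define c where "c t = (if t < 0 then 0 else if t = 0 then 1 else 2 * parity_sign t)" for t :: int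
  let ?E = "\<lambda>B A. eps (Q_op (B - int l') (Q_op (A - int l) 1))"
  have "vac [Psi s J l, Psi s J l'] = (\<Sum>i'\<le>J. \<Sum>i\<le>J. parity_sign (int l') * acoef i' *
      (parity_sign (int l) * acoef i * ?E (int (s * i')) (int (s * i))))"
    by (simp only: vac_def apply_ops_Cons apply_ops_Nil Psi_def shifted_def Q_op_sum Q_op_scalar
        eps_sum eps_scalar sum_distrib_left)
  also have "\<dots> = (\<Sum>i'\<le>J. \<Sum>i\<le>J. parity_sign (int i') * acoef i' *
      (parity_sign (int i) * acoef i * ?E (int (s * i')) (int (s * i))))"
  proof (intro sum.cong refl)
    fix i i'
    show "parity_sign (int l') * acoef i' * (parity_sign (int l) * acoef i * ?E (int (s * i')) (int (s * i)))
      = parity_sign (int i') * acoef i' * (parity_sign (int i) * acoef i * ?E (int (s * i')) (int (s * i)))"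
    proof (cases "int (s * i') - int l' + (int (s * i) - int l) = 0")
      case True
      then have "int l' + int l = int (s * i') + int (s * i)" by simp
      then have "parity_sign (int l' + int l) = parity_sign (int i' + int i)"
        using assms(1) by (simp add: parity_sign_def)
      then have "parity_sign (int l') * parity_sign (int l) = parity_sign (int i') * parity_sign (int i)"
        by (simp only: parity_sign_add)
      then have sign: "parity_sign (int l') * parity_sign (int l) * x
          = parity_sign (int i') * parity_sign (int i) * x" for x
        by (simp only:)
      show ?thesis
        using sign[of "acoef i' * acoef i * ?E (int (s * i')) (int (s * i))"] by (simp only: mult_ac)
    qed (simp add: eps_Q_op_Q_op_1)
  qed
  also have "\<dots> = (\<Sum>i'\<le>J. parity_sign (int i') * acoef i' *
      (\<Sum>A\<in>{0..K}. f_one s A * ?E (int (s * i')) A))"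
  proof -
    have "(\<Sum>i\<le>J. parity_sign (int i) * acoef i * ?E B (int (s * i)))
        = (\<Sum>A\<in>{0..K}. f_one s A * ?E B A)" for B
      unfolding K_def by (rule sum_multiples[OF s])
    then show ?thesis by (simp only: sum_distrib_left[symmetric])
  qed
  also have "\<dots> = (\<Sum>B\<in>{0..K}. f_one s B * (\<Sum>A\<in>{0..K}. f_one s A * ?E B A))"
    unfolding K_def by (rule sum_multiples[OF s])
  also have "\<dots> = (\<Sum>A\<in>{0..K}. f_one s A * (\<Sum>B\<in>{0..K}. f_one s B * ?E B A))"
    by (simp only: sum_distrib_left) (subst sum.swap, simp only: mult.left_commute)
  also have "\<dots> = (\<Sum>A\<in>{0..K}. f_one s A * (f_one s (int l + int l' - A) * c (A - int l)))"
  proof (intro sum.cong refl arg_cong2[of _ _ _ _ "(*)"])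
    fix A assume A: "A \<in> {0..K}"
    have "(\<Sum>B\<in>{0..K}. f_one s B * ?E B A)
        = (\<Sum>B\<in>{0..K}. if B = int l + int l' - A then f_one s B * c (A - int l) else 0)"
      by (rule sum.cong) (auto simp: eps_Q_op_Q_op_1 c_def)
    also have "\<dots> = (if int l + int l' - A \<in> {0..K} then f_one s (int l + int l' - A) * c (A - int l) else 0)"
      by (rule sum.delta) simp
    also have "\<dots> = f_one s (int l + int l' - A) * c (A - int l)"
      using K A by (auto simp: f_one_def)
    finally show "(\<Sum>B\<in>{0..K}. f_one s B * ?E B A) = f_one s (int l + int l' - A) * c (A - int l)" .
  qed
  also have "\<dots> = (\<Sum>A\<in>{int l..int l + int l'}. f_one s A * (f_one s (int l + int l' - A) * c (A - int l)))"
  proof (rule sum.mono_neutral_right)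
    show "\<forall>A\<in>{0..K} - {int l..int l + int l'}.
        f_one s A * (f_one s (int l + int l' - A) * c (A - int l)) = 0"
    proof
      fix A assume "A \<in> {0..K} - {int l..int l + int l'}"
      then consider "A - int l < 0" | "int l + int l' - A < 0" by fastforce
      then show "f_one s A * (f_one s (int l + int l' - A) * c (A - int l)) = 0"
        by cases (simp_all add: c_def f_one_def)
    qed
  qed (use K in auto)
  also have "\<dots> = (\<Sum>t\<in>{0..l'}. f_one s (int l + int t) * (f_one s (int l' - int t) * c (int t)))"
    by (rule sum.reindex_bij_witness[of _ "\<lambda>t. int l + int t" "\<lambda>A. nat (A - int l)"]) (auto simp: algebra_simps)
  also have "\<dots> = f_one s (int l) * f_one s (int l')
      + (\<Sum>t=1..l'. f_one s (int l + int t) * (f_one s (int l' - int t) * c (int t)))"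
    by (simp add: sum.atLeast_Suc_atMost c_def)
  also have "(\<Sum>t=1..l'. f_one s (int l + int t) * (f_one s (int l' - int t) * c (int t)))
      = 2 * (\<Sum>t=1..l'. (-1) ^ t * f_one s (int l + int t) * f_one s (int l' - int t))"
    unfolding sum_distrib_left by (rule sum.cong) (auto simp: c_def parity_sign_nat)
  finally show ?thesis using assms(3) by (simp add: f_two_def)
qed


section \<open>The matrix of a skew shape\<close>

text \<open>
  The operators in the order of the rows of \<open>M_tilde\<close>: the smallest part of $\mu$ stands next to the
  vacuum, and $Q_\mu$ is applied before the adjoints of the parts of $\lambda$, beginning with the
  largest.
\<close>

definition op_list :: "nat \<Rightarrow> nat \<Rightarrow> nat list \<Rightarrow> nat list \<Rightarrow> (gamma \<Rightarrow> gamma) list" where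
  "op_list s J lam mu = map half_Q (rev (pad lam mu)) @ map (Psi s J) lam"

lemma length_op_list: "length (op_list s J lam mu) = length (pad lam mu) + length lam"
  by (simp add: op_list_def)

lemma even_length_pad: "even (length (pad lam mu)) \<longleftrightarrow> even (length lam)"
  by (auto simp: pad_def)

lemma sorted_wrt_pad:
  assumes "strict_partition mu"
  shows "sorted_wrt (>) (pad lam mu)"
  using assms by (auto simp: pad_def strict_partition_def sorted_wrt_append)

lemma add_le_sum_list:
  fixes xs :: "nat list"
  assumes "i < j" "j < length xs"
  shows "xs ! i + xs ! j \<le> sum_list xs"
  using assms
proof (induction xs arbitrary: i j)
  case (Cons x xs)
  then obtain j' where j: "j = Suc j'" "j' < length xs" by (cases j) auto
  show ?case
  proof (cases i)
    case 0
    then show ?thesis using j member_le_sum_list[of "xs ! j'" xs] by simp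
  next
    case (Suc i')
    then show ?thesis using j Cons.IH[of i' j'] Cons.prems by simp
  qed
qed simp

lemma M_tilde_carrier:
  "M_tilde s lam mu \<in> carrier_mat (length (pad lam mu) + length lam) (length (pad lam mu) + length lam)"
  unfolding M_tilde_def Let_def
  by (rule four_block_carrier_mat) (auto simp: Y_mat_def)

lemma M_tilde_entries:
  assumes "i < length (pad lam mu) + length lam" "j < length (pad lam mu) + length lam"
  shows "M_tilde s lam mu $$ (i, j) = (let a = length (pad lam mu) in
    if i < a then if j < a then 0
      else f_one s (int (lam ! (j - a)) - int (pad lam mu ! (a - 1 - i)))
    else if j < a then - f_one s (int (lam ! (i - a)) - int (pad lam mu ! (a - 1 - j)))
    else if i < j then f_two s (lam ! (i - a)) (lam ! (j - a))
    else if j < i then - f_two s (lam ! (j - a)) (lam ! (i - a)) else 0)"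
  using assms by (auto simp: M_tilde_def Let_def X_mat_def Y_mat_def)

lemma M_tilde_upper_entry:
  assumes s: "odd s" and lam: "strict_partition lam" "sum_list lam \<le> J" and mu: "strict_partition mu"
    and ij: "i < length (op_list s J lam mu)" "j < length (op_list s J lam mu)"
  shows "M_tilde s lam mu $$ (i, j) = upper_entry (\<lambda>\<phi> \<psi>. vac [\<phi>, \<psi>]) (op_list s J lam mu) i j"
proof -
  let ?a = "length (pad lam mu)"
  let ?e = "\<lambda>i j. vac [op_list s J lam mu ! i, op_list s J lam mu ! j]"
  have QQ: "?e i j = 0" if "i < j" "j < ?a" for i j
  proof -
    have "pad lam mu ! (?a - Suc i) < pad lam mu ! (?a - Suc j)"
      using that sorted_wrt_nth_less[OF sorted_wrt_pad[OF mu, of lam], of "?a - Suc j" "?a - Suc i"] by simp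
    then show ?thesis
      using that by (simp add: op_list_def nth_append rev_nth vac_half_Q_half_Q)
  qed
  have QP: "?e i j = f_one s (int (lam ! (j - ?a)) - int (pad lam mu ! (?a - 1 - i)))"
    if "i < ?a" "?a \<le> j" "j < ?a + length lam" for i j
  proof -
    have "j - ?a < length lam" using that by simp
    then have "lam ! (j - ?a) \<le> J"
      using lam(2) member_le_sum_list[of "lam ! (j - ?a)" lam] by simp
    then show ?thesis
      using that s by (simp add: op_list_def nth_append rev_nth vac_half_Q_Psi)
  qed
  have PP: "?e i j = f_two s (lam ! (i - ?a)) (lam ! (j - ?a))"
    if "?a \<le> i" "i < j" "j < ?a + length lam" for i j
  proof -
    have "j - ?a < length lam" using that by simp
    then have "lam ! (j - ?a) \<in> set lam" by (rule nth_mem)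
    then have "lam ! (j - ?a) > 0" using lam(1) by (simp add: strict_partition_def)
    moreover have "i - ?a < j - ?a" using that by linarith
    then have "lam ! (i - ?a) + lam ! (j - ?a) \<le> J"
      using \<open>j - ?a < length lam\<close> lam(2) add_le_sum_list[of "i - ?a" "j - ?a" lam] by simp
    ultimately show ?thesis
      using that s by (simp add: op_list_def nth_append vac_Psi_Psi)
  qed
  show ?thesis
    using ij M_tilde_entries[of i lam mu j s] QQ[of i j] QQ[of j i] QP[of i j] QP[of j i]
      PP[of i j] PP[of j i]
    by (auto simp: upper_entry_def length_op_list Let_def)
qed

lemma Pfaffian_M_tilde:
  assumes "odd s" "strict_partition lam" "sum_list lam \<le> J" "strict_partition mu"
  shows "Pfaffian (M_tilde s lam mu) = vac (op_list s J lam mu)"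
proof -
  have "\<forall>\<phi>\<in>set (op_list s J lam mu). fermion \<phi>"
    by (auto simp: op_list_def fermion_half_Q fermion_Psi)
  moreover have "even (length (op_list s J lam mu))"
    by (simp add: length_op_list even_length_pad)
  ultimately have "vac (op_list s J lam mu) = pf_list (\<lambda>\<phi> \<psi>. vac [\<phi>, \<psi>]) (op_list s J lam mu)"
    by (rule vac_eq_pf_list)
  also have "\<dots> = Pfaffian (M_tilde s lam mu)"
    using M_tilde_upper_entry[OF assms] M_tilde_carrier[of s lam mu]
    by (intro Pfaffian_eq_pf_list[symmetric]) (auto simp: length_op_list even_length_pad)
  finally show ?thesis ..
qed

lemma fold_half_Q:
  assumes "\<forall>m\<in>set mu. m > 0"
  shows "apply_ops (map half_Q (rev (pad lam mu))) 1 = scalar (1 / 2 ^ length mu) * Q_fun mu"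
proof -
  have "foldr half_Q mu 1 = scalar (1 / 2 ^ length mu) * Q_fun mu"
    using assms
  proof (induction mu)
    case (Cons m mu)
    have "half_Q m (foldr half_Q mu 1) = half_Q m (scalar (1 / 2 ^ length mu) * Q_fun mu)"
      using Cons by simp
    also have "\<dots> = scalar (1 / 2) * (scalar (1 / 2 ^ length mu) * Q_op (int m) (Q_fun mu))"
      using Cons.prems by (simp add: half_Q_def Q_op_scalar)
    finally have "half_Q m (foldr half_Q mu 1)
        = scalar (1 / 2) * (scalar (1 / 2 ^ length mu) * Q_op (int m) (Q_fun mu))" .
    then show ?case by (simp add: mult.assoc[symmetric] scalar_mult[symmetric])
  qed simp
  moreover have "foldr half_Q (pad lam mu) 1 = foldr half_Q mu 1"
    by (simp add: pad_def half_Q_def Q_op_0_1)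
  moreover have "apply_ops (map half_Q (rev (pad lam mu))) = foldr half_Q (pad lam mu)"
    by (simp add: apply_ops_def fold_map o_def foldr_conv_fold)
  ultimately show ?thesis by simp
qed

theorem pairing_T_mult_Q_fun:
  assumes "odd s" "strict_partition lam" "sum_list lam = sum_list mu + s * k" "strict_partition mu"
  shows "pairing lam (T_mult s k * Q_fun mu) = 2 ^ length mu * Pfaffian (M_tilde s lam mu)"
proof -
  have "s > 0" using assms(1) by (auto intro: gr0I)
  then have J: "k \<le> sum_list lam" using assms(3) by (simp add: trans_le_add2)
  let ?J = "sum_list lam"
  have fermions: "\<forall>\<phi>\<in>set (map (Psi s ?J) lam). fermion \<phi>" by (auto simp: fermion_Psi)
  have "Pfaffian (M_tilde s lam mu) = vac (op_list s ?J lam mu)"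
    using assms by (intro Pfaffian_M_tilde) auto
  also have "\<dots> = eps (apply_ops (map (Psi s ?J) lam) (scalar (1 / 2 ^ length mu) * Q_fun mu))"
    using fold_half_Q[of mu lam] assms(4)
    by (simp add: vac_def op_list_def apply_ops_def strict_partition_def)
  also have "\<dots> = eps (fold (Psi s ?J) lam (Q_fun mu)) / 2 ^ length mu"
    by (simp add: apply_ops_scalar[OF fermions] eps_scalar fold_Psi_conv)
  also have "eps (fold (Psi s ?J) lam (Q_fun mu)) = pairing lam (T_mult s k * Q_fun mu)"
    unfolding pairing_def using assms J
    by (intro eps_fold_Q_adj_T_mult[symmetric, OF _ homog_Q_fun]) auto
  finally show ?thesis by simp
qed

lemma pairing_T_mult_Q_fun_degree:
  assumes "odd s" "sum_list lam \<noteq> sum_list mu + s * k"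
  shows "pairing lam (T_mult s k * Q_fun mu) = 0"
  unfolding pairing_def using assms(2)
  by (intro eps_fold_Q_adj_T_mult_eq_0[OF assms(1) homog_Q_fun]) (simp flip: of_nat_add of_nat_mult)

text \<open>
  If $\mu_q > \lambda_q$, then the rows of $\mu_1, \dots, \mu_q$ have nonzero entries only in the
  columns of $\lambda_1, \dots, \lambda_{q-1}$.
\<close>

lemma Pfaffian_M_tilde_eq_0:
  assumes s: "odd s" and lam: "strict_partition lam" and mu: "strict_partition mu"
    and not_subset: "\<not> part_subset mu lam"
  shows "Pfaffian (M_tilde s lam mu) = 0"
proof -
  let ?a = "length (pad lam mu)"
  let ?xs = "op_list s (sum_list lam) lam mu"
  let ?e = "\<lambda>\<phi> \<psi>. vac [\<phi>, \<psi>]"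
  obtain q where q: "part lam q < part mu q"
    using not_subset by (auto simp: part_subset_def not_le)
  then have q_len: "q < length mu" and q_mu: "part mu q = mu ! q"
    by (auto simp: part_def split: if_splits)
  have pad: "pad lam mu ! p = mu ! p" if "p < length mu" for p
    using that by (simp add: pad_def nth_append)
  have a: "length mu \<le> ?a" by (simp add: pad_def)
  have half: "2 * (length ?xs div 2) = ?a + length lam"
    using even_length_pad[of lam mu] by (simp add: length_op_list)
  have "pf_sum (length ?xs div 2) (upper_entry ?e ?xs) = 0"
  proof (rule pf_sum_eq_0)
    show "upper_entry ?e ?xs j i = - upper_entry ?e ?xs i j" for i j
      by (simp add: upper_entry_def)
    show "finite {?a..<?a + q}" by simp
    show "card {?a..<?a + q} < card {?a - Suc q..<?a}"
      using q_len a by simp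
    show "{?a - Suc q..<?a} \<subseteq> {..<2 * (length ?xs div 2)}"
      unfolding half by auto
    fix i j
    assume i: "i \<in> {?a - Suc q..<?a}" and j: "j < 2 * (length ?xs div 2)"
      and nz: "upper_entry ?e ?xs i j \<noteq> 0"
    have ij: "i < ?a + length lam" "j < ?a + length lam"
      using i j half by auto
    then have "M_tilde s lam mu $$ (i, j) \<noteq> 0"
      using nz M_tilde_upper_entry[OF s lam order_refl mu, of i j] by (simp add: length_op_list)
    then have ja: "?a \<le> j" and f: "f_one s (int (lam ! (j - ?a)) - int (pad lam mu ! (?a - 1 - i))) \<noteq> 0"
      using M_tilde_entries[OF ij, of s] i by (auto simp: Let_def split: if_splits)
    from i have p: "?a - 1 - i \<le> q" by auto
    then have "mu ! q \<le> mu ! (?a - 1 - i)"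
      using q_len mu sorted_wrt_nth_less[of "(>)" mu "?a - 1 - i" q]
      by (cases "?a - 1 - i = q") (auto simp: strict_partition_def)
    moreover have "int (pad lam mu ! (?a - 1 - i)) \<le> int (lam ! (j - ?a))"
      using f by (auto simp: f_one_def split: if_splits)
    ultimately have gt: "part lam q < lam ! (j - ?a)"
      using q q_mu p q_len pad[of "?a - 1 - i"] by simp
    have "j - ?a < q"
    proof (rule ccontr)
      assume "\<not> j - ?a < q"
      then have "q \<le> j - ?a" by simp
      moreover have "j - ?a < length lam" using ij ja by simp
      ultimately have "lam ! (j - ?a) \<le> part lam q"
        using lam sorted_wrt_nth_less[of "(>)" lam q "j - ?a"]
        by (cases "q = j - ?a") (auto simp: strict_partition_def part_def)
      with gt show False by simp
    qed
    then show "j \<in> {?a..<?a + q}" using ja by auto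
  qed
  moreover have "Pfaffian (M_tilde s lam mu) = pf_list ?e ?xs"
    using M_tilde_upper_entry[OF s lam order_refl mu] M_tilde_carrier[of s lam mu]
    by (intro Pfaffian_eq_pf_list) (auto simp: length_op_list even_length_pad)
  ultimately show ?thesis by (simp add: pf_list_def)
qed

theorem corollary3p5:
  fixes s k n :: nat and mu :: "nat list"
  assumes "odd s" and "s > 0" and "k > 0"
    and "strict_partition_of n mu"
  shows "T_op s k (Q_fun mu) =
    (\<Sum>lam | strict_partition_of (n + s * k) lam \<and> part_subset mu lam.
       scalar (2 powi (int (length mu) - int (length lam)) * Pfaffian (M_tilde s lam mu))
         * Q_fun lam)"
proof -
  let ?S = "{lam. strict_partition_of (n + s * k) lam \<and> part_subset mu lam}"
  have mu: "strict_partition mu" "sum_list mu = n"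
    using assms(4) by (simp_all add: strict_partition_of_def)
  have "finite ?S"
    using finite_strict_partition_of by (rule rev_finite_subset) auto
  then have "T_op s k (Q_fun mu)
      = (\<Sum>lam\<in>?S. scalar (pairing lam (T_op s k (Q_fun mu)) / 2 ^ length lam) * Q_fun lam)"
  proof (rule Q_fun_expansion)
    fix lam assume "strict_partition lam" "lam \<notin> ?S"
    then show "pairing lam (T_op s k (Q_fun mu)) = 0"
      using pairing_T_mult_Q_fun_degree[OF assms(1), of lam mu k]
        pairing_T_mult_Q_fun[OF assms(1), of lam mu k] Pfaffian_M_tilde_eq_0[OF assms(1), of lam mu] mu
      by (auto simp: T_op_def strict_partition_of_def)
  qed (simp add: strict_partition_of_def)
  also have "\<dots> = (\<Sum>lam\<in>?S. scalar (2 powi (int (length mu) - int (length lam))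
      * Pfaffian (M_tilde s lam mu)) * Q_fun lam)"
  proof (rule sum.cong[OF refl])
    fix lam assume "lam \<in> ?S"
    then have "pairing lam (T_op s k (Q_fun mu)) = 2 ^ length mu * Pfaffian (M_tilde s lam mu)"
      using pairing_T_mult_Q_fun[OF assms(1), of lam mu k] mu
      by (simp add: T_op_def strict_partition_of_def)
    then have "pairing lam (T_op s k (Q_fun mu)) / 2 ^ length lam
        = 2 powi (int (length mu) - int (length lam)) * Pfaffian (M_tilde s lam mu)"
      by (simp add: power_int_diff)
    then show "scalar (pairing lam (T_op s k (Q_fun mu)) / 2 ^ length lam) * Q_fun lam
        = scalar (2 powi (int (length mu) - int (length lam)) * Pfaffian (M_tilde s lam mu)) * Q_fun lam"
      by simp
  qed
  finally show ?thesis .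
qed

end
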